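(* Assume $\mathfrak t=\mathfrak c$ (e.g. CH). Then there exist sets $L_0,L_1\subseteq[\mathbb N]^\infty$ such that, with $L=L_0\cup L_1$: (1) $L_0$ and $L_1$ each satisfy $\mathrm{Split}(B_\Omega,B_\Omega)$ and $\mathrm{Split}(B_\Lambda,B_\Lambda)$; (2) $L$ satisfies $\mathrm{Split}(B_\Lambda,B_\Lambda)$; (3) neither $L_0\times L_1$ nor $L\times L$ satisfies $\mathrm{Split}(C_{\mathrm T^*},C_\Lambda)$; (4) some subset of $L_0\times L_1$ does not satisfy $\mathrm{Split}(C_{\mathrm T},C_{\mathrm T})$. In particular, $\mathrm{Split}(\Lambda,\Lambda)$ and $\mathrm{Split}(\Omega,\Lambda)$ (and their Borel and clopen versions) are not provably closed under finite powers, and $\mathrm{Split}(\Omega,\Omega)$ (and its Borel and clopen versions) is not provably closed under finite products.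
   Context: $[\mathbb N]^\infty$ is the set of infinite subsets of $\mathbb N$, a subspace of $P(\mathbb N)\cong\{0,1\}^{\mathbb N}$; products carry the product topology. A cover of a space $X$ is a family $\mathcal U$ of subsets of $X$ with $\bigcup\mathcal U=X$ such that $X\not\subseteq U$ for all $U\in\mathcal U$. A cover $\mathcal U$ is: a large cover if every $x\in X$ lies in infinitely many members; an $\omega$-cover if every finite subset of $X$ is contained in some member; a $\tau$-cover if it is large and for all $x,y\in X$ at least one of $\{U\in\mathcal U: x\in U, y\notin U\}$, $\{U\in\mathcal U: y\in U, x\notin U\}$ is finite. For a countable cover $\mathcal U=\{U_n\}_{n\in a}$ (bijective enumeration, $a\subseteq\mathbb N$) let $h_{\mathcal U}(x)=\{n\in a:x\in U_n\}$. For $a,b\subseteq\mathbb N$, $a\subseteq^*b$ means $a\setminus b$ is finite. A family $Y$ of infinite subsets of $\mathbb N$ is linearly refinable if for each $y\in Y$ there is an infinite $\hat y\subseteq y$ with $\{\hat y:y\in Y\}$ linearly ordered by $\subseteq^*$; a countable cover $\mathcal U$ is a $\tau^*$-cover if $h_{\mathcal U}[X]$ consists of infinite sets and is linearly refinable. $\Lambda,\Omega$ are the collections of open large covers and open $\omega$-covers; $B_\Lambda,B_\Omega$ the countable Borel large/$\omega$-covers; $C_\Lambda,C_{\mathrm T},C_{\mathrm T^*}$ the countable clopen large covers, $\tau$-covers, $\tau^*$-covers. A space satisfies $\mathrm{Split}(\mathfrak U,\mathfrak V)$ if every $\mathcal U\in\mathfrak U$ can be partitioned into two disjoint subfamilies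 each containing a subfamily belonging to $\mathfrak V$. $\mathfrak t$ is the minimal length $\kappa$ of a sequence $\langle a_\alpha:\alpha<\kappa\rangle$ of infinite subsets of $\mathbb N$, decreasing with respect to $\subseteq^*$, having no infinite $a\subseteq\mathbb N$ with $a\subseteq^* a_\alpha$ for all $\alpha$; $\mathfrak c=2^{\aleph_0}$. *)

theory Defs
  imports "HOL-Analysis.Analysis"
begin

definition cantor_top :: "nat set topology" where
  "cantor_top = pullback_topology UNIV (\<lambda>A n. n \<in> A)
     (product_topology (\<lambda>_. discrete_topology (UNIV :: bool set)) UNIV)"

definition inf_subsets :: "nat set set" where
  "inf_subsets = {A. infinite A}"

definition almost_subset :: "nat set \<Rightarrow> nat set \<Rightarrow> bool" where
  "almost_subset a b \<longleftrightarrow> finite (a - b)"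

definition is_cover :: "'a set \<Rightarrow> 'a set set \<Rightarrow> bool" where
  "is_cover X \<U> \<longleftrightarrow> \<Union>\<U> = X \<and> (\<forall>U\<in>\<U>. \<not> X \<subseteq> U)"

definition large_cover :: "'a set \<Rightarrow> 'a set set \<Rightarrow> bool" where
  "large_cover X \<U> \<longleftrightarrow> is_cover X \<U> \<and> (\<forall>x\<in>X. infinite {U\<in>\<U>. x \<in> U})"

definition omega_cover :: "'a set \<Rightarrow> 'a set set \<Rightarrow> bool" where
  "omega_cover X \<U> \<longleftrightarrow> is_cover X \<U> \<and> (\<forall>F. finite F \<and> F \<subseteq> X \<longrightarrow> (\<exists>U\<in>\<U>. F \<subseteq> U))"

definition tau_cover :: "'a set \<Rightarrow> 'a set set \<Rightarrow> bool" where
  "tau_cover X \<U> \<longleftrightarrow> large_cover X \<U> \<and>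
     (\<forall>x\<in>X. \<forall>y\<in>X. finite {U\<in>\<U>. x \<in> U \<and> y \<notin> U} \<or> finite {U\<in>\<U>. y \<in> U \<and> x \<notin> U})"

definition linearly_refinable :: "nat set set \<Rightarrow> bool" where
  "linearly_refinable Y \<longleftrightarrow> (\<exists>f. (\<forall>y\<in>Y. f y \<subseteq> y \<and> infinite (f y)) \<and>
     (\<forall>y\<in>Y. \<forall>z\<in>Y. almost_subset (f y) (f z) \<or> almost_subset (f z) (f y)))"

definition tau_star_cover :: "'a set \<Rightarrow> 'a set set \<Rightarrow> bool" where
  "tau_star_cover X \<U> \<longleftrightarrow> is_cover X \<U> \<and>
     (\<exists>(a::nat set) e. bij_betw e a \<U> \<and>
        (\<forall>x\<in>X. infinite {n\<in>a. x \<in> e n}) \<and>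
        linearly_refinable ((\<lambda>x. {n\<in>a. x \<in> e n}) ` X))"

definition borel_in :: "'a topology \<Rightarrow> 'a set \<Rightarrow> bool" where
  "borel_in T B \<longleftrightarrow> B \<in> sigma_sets (topspace T) {U. openin T U}"

definition Lambda_covers :: "'a topology \<Rightarrow> 'a set set set" where
  "Lambda_covers T = {\<U>. large_cover (topspace T) \<U> \<and> (\<forall>U\<in>\<U>. openin T U)}"

definition Omega_covers :: "'a topology \<Rightarrow> 'a set set set" where
  "Omega_covers T = {\<U>. omega_cover (topspace T) \<U> \<and> (\<forall>U\<in>\<U>. openin T U)}"

definition B_Lambda :: "'a topology \<Rightarrow> 'a set set set" where
  "B_Lambda T = {\<U>. countable \<U> \<and> large_cover (topspace T) \<U> \<and> (\<forall>U\<in>\<U>. borel_in T U)}"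

definition B_Omega :: "'a topology \<Rightarrow> 'a set set set" where
  "B_Omega T = {\<U>. countable \<U> \<and> omega_cover (topspace T) \<U> \<and> (\<forall>U\<in>\<U>. borel_in T U)}"

definition C_Lambda :: "'a topology \<Rightarrow> 'a set set set" where
  "C_Lambda T = {\<U>. countable \<U> \<and> large_cover (topspace T) \<U> \<and>
     (\<forall>U\<in>\<U>. openin T U \<and> closedin T U)}"

definition C_T :: "'a topology \<Rightarrow> 'a set set set" where
  "C_T T = {\<U>. countable \<U> \<and> tau_cover (topspace T) \<U> \<and>
     (\<forall>U\<in>\<U>. openin T U \<and> closedin T U)}"

definition C_Tstar :: "'a topology \<Rightarrow> 'a set set set" where
  "C_Tstar T = {\<U>. countable \<U> \<and> tau_star_cover (topspace T) \<U> \<and>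
     (\<forall>U\<in>\<U>. openin T U \<and> closedin T U)}"

definition Split :: "('a topology \<Rightarrow> 'a set set set) \<Rightarrow> ('a topology \<Rightarrow> 'a set set set)
    \<Rightarrow> 'a topology \<Rightarrow> bool" where
  "Split \<UU> \<VV> T \<longleftrightarrow> (\<forall>\<U>\<in>\<UU> T. \<exists>\<V>1 \<V>2. \<V>1 \<union> \<V>2 = \<U> \<and> \<V>1 \<inter> \<V>2 = {} \<and>
      (\<exists>\<W>1\<subseteq>\<V>1. \<W>1 \<in> \<VV> T) \<and> (\<exists>\<W>2\<subseteq>\<V>2. \<W>2 \<in> \<VV> T))"

definition is_tower :: "'i rel \<Rightarrow> ('i \<Rightarrow> nat set) \<Rightarrow> bool" where
  "is_tower r a \<longleftrightarrow> Well_order r \<and> (\<forall>\<alpha>\<in>Field r. infinite (a \<alpha>)) \<and>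
     (\<forall>\<alpha> \<beta>. (\<alpha>, \<beta>) \<in> r \<longrightarrow> almost_subset (a \<beta>) (a \<alpha>))"

definition has_pseudo_intersection :: "'i rel \<Rightarrow> ('i \<Rightarrow> nat set) \<Rightarrow> bool" where
  "has_pseudo_intersection r a \<longleftrightarrow> (\<exists>b. infinite b \<and> (\<forall>\<alpha>\<in>Field r. almost_subset b (a \<alpha>)))"

text \<open>\<open>t = c\<close>: (given the ZFC fact \<open>t \<le> c\<close>) every tower of length \<open>< c\<close> has a
  pseudo-intersection. Index type \<open>nat set\<close> has size c, so every order type \<open>< c\<close> occurs.\<close>
definition t_eq_c :: bool where
  "t_eq_c \<longleftrightarrow> (\<forall>(r :: nat set rel) a.
     is_tower r a \<and> (card_of (Field r), card_of (UNIV :: nat set set)) \<in> ordLess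
       \<longrightarrow> has_pseudo_intersection r a)"

end

theory Submission
  imports Defs
begin

text \<open>
  Under \<open>\<t> = \<c>\<close> fewer than continuum many meager sets do not cover the Cantor space and fewer than
  continuum many infinite sets can be split simultaneously. Build by recursion a tower generating an
  ultrafilter: at each stage take \<open>a\<close> almost below the tower and deciding the next set, let \<open>x\<close> be
  Cohen generic over everything chosen so far, and put \<open>y = x \<triangle> a\<close>, which is again generic; the next
  tower element is \<open>a \<inter> x = x - y\<close>. Thus every \<open>x\<close> is in the ultrafilter and no \<open>y\<close> is, so every
  sum of an \<open>x\<close> and a \<open>y\<close> is in the ultrafilter, and these sums include a base of it, hence cannot be
  split. In contrast the set \<open>L0\<close> of all \<open>x\<close> consists of mutually generic points, and so does the
  set \<open>L1\<close> of all \<open>y\<close>: a set splitting the values of a given Borel map (and their finite intersections)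
  at the earlier points also splits them at all later ones.
\<close>

section \<open>Consequences of \<open>\<t> = \<c>\<close>\<close>

text \<open>The obstacle is that a pair \<open>(x i, y i)\<close> with prescribed sum cannot be
  generic in the product. Only genericity of each coordinate over the earlier points of its own
  family is used: translation by a fixed set preserves comeagerness, so every demand on
  \<open>y i\<close> is a comeager demand on \<open>x i\<close>. One splitting set is chosen for
  both families at once and therefore splits the value at each single point of
  \<open>L0 \<union> L1\<close>. Intersections of values are controlled within \<open>L0\<close> and
  within \<open>L1\<close>, but not across. Hence the union inherits the property for large covers,
  while the property for \<omega>-covers is obtained for the two parts separately. The number
  \<open>0\<close> is a marker: it lies in every \<open>x i\<close> and in no \<open>y i\<close>, so
  a clopen condition tells the four rectangles of the square of the union apart as far as the cover
  needs it.\<close>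

definition small :: "'a set \<Rightarrow> bool" where
  "small A \<longleftrightarrow> (card_of A, card_of (UNIV :: nat set set)) \<in> ordLess"

lemma small_image: "small A \<Longrightarrow> small (f ` A)"
  unfolding small_def using card_of_image ordLeq_ordLess_trans by blast

lemma small_subset: "small B \<Longrightarrow> A \<subseteq> B \<Longrightarrow> small A"
  unfolding small_def using card_of_mono1 ordLeq_ordLess_trans by blast

lemma infinite_UNIV_nat_set: "infinite (UNIV :: nat set set)"
  by (simp add: Finite_Set.finite_set)

lemma small_Un: "small A \<Longrightarrow> small B \<Longrightarrow> small (A \<union> B)"
  unfolding small_def by (rule card_of_Un_ordLess_infinite[OF infinite_UNIV_nat_set])

lemma small_nat: "small (UNIV :: nat set)"
  unfolding small_def using card_of_Pow[of "UNIV :: nat set"] by simp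

lemma small_countable: "countable A \<Longrightarrow> small A"
  by (metis small_nat small_image small_subset countable_as_injective_image_subset subset_UNIV)

lemma small_Times:
  assumes "small A" "small B"
  shows "small (A \<times> B)"
proof -
  have "small (Inl ` A \<union> Inr ` B)"
    using assms small_image small_Un by metis
  then have E: "small (A <+> B)"
    unfolding Plus_def .
  show ?thesis
  proof (cases "finite (A <+> B)")
    case True
    then have "finite (A \<times> B)"
      by auto
    then show ?thesis
      using small_countable countable_finite by blast
  next
    case False
    have "(card_of ((A <+> B) \<times> (A <+> B)), card_of (A <+> B)) \<in> ordLeq"
      using card_of_Times_same_infinite[OF False] ordIso_iff_ordLeq by blast
    then have "small ((A <+> B) \<times> (A <+> B))"
      using E ordLeq_ordLess_trans unfolding small_def by blast
    moreover have "A \<times> B = (\<lambda>(u, v). (projl u, projr v)) ` (Inl ` A \<times> Inr ` B)"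
      by force
    moreover have "Inl ` A \<times> Inr ` B \<subseteq> (A <+> B) \<times> (A <+> B)"
      by auto
    ultimately show ?thesis
      using small_image small_subset by metis
  qed
qed

lemma small_Fpow:
  fixes A :: "'a set"
  assumes "small A"
  shows "small (Fpow A)"
proof -
  \<comment> \<open>The summand \<open>nat\<close> makes the bounding set infinite, so that cardinal
    arithmetic applies even if \<open>A\<close> is finite.\<close>
  define B where "B = A <+> (UNIV :: nat set)"
  define S where "S n = {F. F \<subseteq> A \<and> finite F \<and> card F = n}" for n
  have B: "infinite B" "small B"
  proof -
    show "infinite B"
      unfolding B_def by simp
    have "B = Inl ` A \<union> Inr ` UNIV"
      unfolding B_def by auto
    then show "small B"
      using small_Un small_image assms small_nat by metis
  qed
  have AB: "(card_of A, card_of B) \<in> ordLeq"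
    unfolding B_def by (rule card_of_Plus1)
  have NB: "(card_of (UNIV :: nat set), card_of B) \<in> ordLeq"
    unfolding B_def by (rule card_of_Plus2)
  have S: "(card_of (S n), card_of B) \<in> ordLeq" for n
  proof (induction n)
    case 0
    have "S 0 \<subseteq> {{}}"
      unfolding S_def by auto
    then have "finite (S 0)"
      using finite_subset by blast
    then show ?case
      using B(1) by (intro ordLess_imp_ordLeq finite_ordLess_infinite)
        (auto simp: card_of_well_order_on Field_card_of)
  next
    case (Suc n)
    have "S (Suc n) \<subseteq> (\<lambda>(x, F). insert x F) ` (A \<times> S n)"
    proof
      fix F assume F: "F \<in> S (Suc n)"
      then obtain x where "x \<in> F"
        unfolding S_def by fastforce
      then have "x \<in> A" "F - {x} \<in> S n" "insert x (F - {x}) = F"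
        using F unfolding S_def by auto
      then show "F \<in> (\<lambda>(x, F). insert x F) ` (A \<times> S n)"
        by (intro image_eqI[of _ _ "(x, F - {x})"]) auto
    qed
    then have "(card_of (S (Suc n)), card_of (A \<times> S n)) \<in> ordLeq"
      using card_of_mono1 card_of_image ordLeq_transitive by blast
    moreover have "(card_of (A \<times> S n), card_of B) \<in> ordLeq"
      using card_of_Times_ordLeq_infinite_Field[of "card_of B"] B(1) AB Suc card_of_card_order_on[of B]
      by (simp add: Field_card_of)
    ultimately show ?case
      using ordLeq_transitive by blast
  qed
  have "Fpow A = (\<Union>n. S n)"
    unfolding Fpow_def S_def by auto
  moreover have "(card_of (\<Union>n. S n), card_of B) \<in> ordLeq"
    using card_of_UNION_ordLeq_infinite[OF B(1) NB] S by blast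
  ultimately show ?thesis
    using B(2) ordLeq_ordLess_trans unfolding small_def by fastforce
qed

section \<open>Almost inclusion and closed preorders\<close>

lemma almost_subset_refl: "almost_subset a a"
  by (simp add: almost_subset_def)

lemma almost_subset_trans: "almost_subset a b \<Longrightarrow> almost_subset b c \<Longrightarrow> almost_subset a c"
  unfolding almost_subset_def by (rule finite_subset[of _ "(a - b) \<union> (b - c)"]) auto

lemma almost_subset_mono: "almost_subset a b \<Longrightarrow> a' \<subseteq> a \<Longrightarrow> b \<subseteq> b' \<Longrightarrow> almost_subset a' b'"
  unfolding almost_subset_def by (rule finite_subset[of _ "a - b"]) auto

lemma almost_subset_infinite: "almost_subset a b \<Longrightarrow> infinite a \<Longrightarrow> infinite (a \<inter> b)"
  unfolding almost_subset_def
  using Int_Diff_Un[of a b] by (metis finite_Un)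

lemma Well_order_Restr_underS:
  assumes "Well_order r"
  shows "Well_order (Restr r (underS r i))" "Field (Restr r (underS r i)) = underS r i"
proof -
  show "Well_order (Restr r (underS r i))"
    by (rule Well_order_Restr[OF assms])
  have "underS r i \<subseteq> Field r"
    by (auto simp: underS_def Field_def)
  then show "Field (Restr r (underS r i)) = underS r i"
    using Refl_Field_Restr2[of r "underS r i"] assms by (simp add: order_on_defs)
qed

text \<open>Transfinite recursion along a well-order of the family: \<open>closed\<close> bounds the
  earlier conditions, \<open>dense\<close> strengthens the bound into the next set, and
  \<open>closed\<close> once more bounds the whole sequence. The sets in the family need not be
  closed downward, so \<open>q\<close> is only placed below a member of each; for almost inclusion
  this costs finitely many elements.\<close>

lemma closed_preorder_meets_dense:
  fixes le :: "'p \<Rightarrow> 'p \<Rightarrow> bool"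
  assumes refl: "\<And>p. le p p"
    and trans: "\<And>p q r. le p q \<Longrightarrow> le q r \<Longrightarrow> le p r"
    and closed: "\<And>(r :: nat set rel) p. Well_order r \<Longrightarrow> small (Field r) \<Longrightarrow>
      (\<And>i. i \<in> Field r \<Longrightarrow> p i \<in> P) \<Longrightarrow> (\<And>i j. (i, j) \<in> r \<Longrightarrow> le (p j) (p i)) \<Longrightarrow>
      \<exists>q\<in>P. \<forall>i\<in>Field r. le q (p i)"
    and small: "small \<D>"
    and dense: "\<And>D p. D \<in> \<D> \<Longrightarrow> p \<in> P \<Longrightarrow> \<exists>q\<in>P \<inter> D. le q p"
  shows "\<exists>q\<in>P. \<forall>D\<in>\<D>. \<exists>p\<in>P \<inter> D. le q p"
proof -
  obtain g :: "_ \<Rightarrow> nat set" where g: "inj_on g \<D>"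
    using ordLess_imp_ordLeq[OF small[unfolded small_def]] card_of_ordLeq[of \<D> "UNIV :: nat set set"] by auto
  define I where "I = g ` \<D>"
  define r where "r = card_of I"
  define D where "D i = inv_into \<D> g i" for i
  have D: "D i \<in> \<D>" if "i \<in> I" for i
    using that unfolding D_def I_def by (simp add: inv_into_into)
  have wo: "Well_order r" "Field r = I"
    unfolding r_def by (rule card_of_Well_order, rule Field_card_of)
  have wf: "wf (r - Id)"
    using wo(1) unfolding well_order_on_def by blast
  have sI: "small I"
    unfolding I_def using small small_image by blast
  \<comment> \<open>The recursion runs over the whole index type, so the demand is restricted to
    \<open>i \<in> I\<close>.\<close>
  define Q where "Q f i v \<longleftrightarrow> (i \<in> I \<longrightarrow> v \<in> P \<inter> D i \<and> (\<forall>j. (j, i) \<in> r - Id \<longrightarrow> le v (f j)))"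
    for f :: "nat set \<Rightarrow> 'p" and i v
  have "\<exists>f. \<forall>i. Q f i (f i)"
  proof (rule dependent_wf_choice[OF wf])
    show "Q f x v = Q g x v" if "\<And>z. (z, x) \<in> r - Id \<Longrightarrow> f z = g z" for f g x v
      unfolding Q_def using that by auto
    fix i f assume prev: "\<And>j. (j, i) \<in> r - Id \<Longrightarrow> Q f j (f j)"
    show "\<exists>v. Q f i v"
    proof (cases "i \<in> I")
      case True
      define r' where "r' = Restr r (underS r i)"
      have sub: "underS r i \<subseteq> Field r"
        by (auto simp: underS_def Field_def)
      have F': "Field r' = underS r i"
        unfolding r'_def by (rule Well_order_Restr_underS(2)[OF wo(1)])
      have "Well_order r'"
        unfolding r'_def by (rule Well_order_Restr_underS(1)[OF wo(1)])
      moreover have "small (Field r')"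
        using F' sub wo(2) sI small_subset by metis
      moreover have "f j \<in> P" if "j \<in> Field r'" for j
        using prev[of j] that sub wo(2) F' unfolding Q_def underS_def by auto
      moreover have "le (f k) (f j)" if "(j, k) \<in> r'" for j k
      proof (cases "j = k")
        case False
        have k: "(k, i) \<in> r - Id" "(j, k) \<in> r - Id"
          using that False unfolding r'_def underS_def by auto
        then have "k \<in> I"
          using wo(2) by (auto simp: Field_def)
        then show ?thesis
          using prev[OF k(1)] k(2) unfolding Q_def by auto
      qed (simp add: refl)
      ultimately obtain q where q: "q \<in> P" "\<forall>j\<in>underS r i. le q (f j)"
        using closed[of r' f] F' by auto
      obtain v where "v \<in> P \<inter> D i" "le v q"
        using dense[OF D[OF True] q(1)] by blast
      then have "Q f i v"
        unfolding Q_def using q(2) trans by (auto simp: underS_def)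
      then show ?thesis ..
    qed (auto simp: Q_def)
  qed
  then obtain f where f: "\<And>i. Q f i (f i)"
    by blast
  have "\<exists>q\<in>P. \<forall>i\<in>Field r. le q (f i)"
  proof (rule closed[OF wo(1)])
    show "small (Field r)"
      using sI wo(2) by simp
    show "f i \<in> P" if "i \<in> Field r" for i
      using that wo(2) f[of i] unfolding Q_def by auto
    show "le (f j) (f i)" if "(i, j) \<in> r" for i j
    proof (cases "i = j")
      case False
      have "j \<in> I"
        using that wo(2) by (auto simp: Field_def)
      then show ?thesis
        using that False f[of j] unfolding Q_def by auto
    qed (simp add: refl)
  qed
  then obtain q where q: "q \<in> P" "\<forall>i\<in>I. le q (f i)"
    using wo(2) by auto
  have "\<exists>p\<in>P \<inter> A. le q p" if "A \<in> \<D>" for A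
  proof -
    have "g A \<in> I" "D (g A) = A"
      using that g unfolding I_def D_def by auto
    then show ?thesis
      using q(2) f[of "g A"] unfolding Q_def by auto
  qed
  then show ?thesis
    using q(1) by blast
qed

lemma tower_pseudo_intersection:
  fixes a :: "nat set \<Rightarrow> nat set"
  assumes "t_eq_c" "Well_order r" "small (Field r)"
    and "\<And>i. i \<in> Field r \<Longrightarrow> infinite (a i)"
    and "\<And>i j. (i, j) \<in> r \<Longrightarrow> almost_subset (a j) (a i)"
  shows "\<exists>b. infinite b \<and> (\<forall>i\<in>Field r. almost_subset b (a i))"
proof -
  have "is_tower r a"
    unfolding is_tower_def using assms(2,4,5) by simp
  then have "has_pseudo_intersection r a"
    using assms(1,3) unfolding t_eq_c_def small_def by simp
  then show ?thesis
    unfolding has_pseudo_intersection_def .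
qed

section \<open>Dominating functions\<close>

text \<open>Greedy choice, each element above all values of \<open>g\<close> up to the previous one.
  This is the density needed for \<open>small_family_dominated\<close>.\<close>

lemma thin_subset:
  fixes g :: "nat \<Rightarrow> nat" and A :: "nat set"
  assumes "infinite A"
  obtains B where "B \<subseteq> A" "infinite B"
    "\<And>u v m. u \<in> B \<Longrightarrow> v \<in> B \<Longrightarrow> u < v \<Longrightarrow> m \<le> u \<Longrightarrow> g m \<le> v"
proof -
  have ex: "\<exists>w\<in>A. z < w" for z
    using assms unfolding infinite_nat_iff_unbounded by blast
  have "\<exists>k. \<forall>i. k i \<in> A \<and> (k i < k (Suc i) \<and> (\<forall>m\<le>k i. g m \<le> k (Suc i)))"
  proof (rule dependent_nat_choice)
    show "\<exists>x. x \<in> A"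
      using ex by blast
    fix x
    \<comment> \<open>The sum majorises every \<open>g m\<close> with \<open>m \<le> x\<close>, and
      the summand \<open>x\<close> makes the sequence increase.\<close>
    obtain w where w: "w \<in> A" "x + sum g {..x} < w"
      using ex by blast
    have "g m \<le> w" if "m \<le> x" for m
      using w(2) member_le_sum[of m "{..x}" g] that by simp
    moreover have "x < w"
      using w(2) by linarith
    ultimately show "\<exists>y. y \<in> A \<and> x < y \<and> (\<forall>m\<le>x. g m \<le> y)"
      using w(1) by blast
  qed
  then obtain k where k: "\<And>i. k i \<in> A" "\<And>i. k i < k (Suc i)" "\<And>i m. m \<le> k i \<Longrightarrow> g m \<le> k (Suc i)"
    by blast
  have sm: "strict_mono k"
    using k(2) by (simp add: strict_mono_Suc_iff)
  show thesis
  proof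
    show "range k \<subseteq> A"
      using k(1) by auto
    show "infinite (range k)"
      using sm by (simp add: finite_image_iff strict_mono_imp_inj_on)
    fix u v m assume "u \<in> range k" "v \<in> range k" "u < v" "m \<le> u"
    then obtain i j where ij: "u = k i" "v = k j" "i < j"
      using sm by (auto simp: strict_mono_less)
    then have "g m \<le> k (Suc i)" "k (Suc i) \<le> k j"
      using k(3) \<open>m \<le> u\<close> sm by (auto simp: strict_mono_less_eq)
    then show "g m \<le> v"
      using ij by simp
  qed
qed

text \<open>This is \<open>\<t> \<le> \<b>\<close>: the second element of a sufficiently sparse set above \<open>n\<close>,
  as a function of \<open>n\<close>, dominates, and sparseness survives passing to almost subsets.\<close>

lemma small_family_dominated:
  fixes G :: "(nat \<Rightarrow> nat) set"
  assumes t: "t_eq_c" and "small G"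
  obtains F where "\<And>g. g \<in> G \<Longrightarrow> \<exists>k. \<forall>n\<ge>k. g n \<le> F n"
proof -
  define D where "D g = {B :: nat set. \<forall>u\<in>B. \<forall>v\<in>B. u < v \<longrightarrow> (\<forall>m\<le>u. g m \<le> v)}" for g :: "nat \<Rightarrow> nat"
  have "\<exists>q\<in>{B :: nat set. infinite B}. \<forall>A\<in>D ` G. \<exists>p\<in>{B. infinite B} \<inter> A. almost_subset q p"
  proof (rule closed_preorder_meets_dense[where le = almost_subset])
    show "\<exists>q\<in>{B. infinite B}. \<forall>i\<in>Field r. almost_subset q (p i)"
      if "Well_order r" "small (Field r)" "\<And>i. i \<in> Field r \<Longrightarrow> p i \<in> {B. infinite B}"
        "\<And>i j. (i, j) \<in> r \<Longrightarrow> almost_subset (p j) (p i)" for r :: "nat set rel" and p :: "nat set \<Rightarrow> nat set"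
      using tower_pseudo_intersection[OF t that(1,2), of p] that(3,4) by auto
    show "small (D ` G)"
      using assms small_image by blast
    fix E and p :: "nat set"
    assume "E \<in> D ` G" and p: "p \<in> {B. infinite B}"
    then obtain g where g: "E = D g" by blast
    obtain B where "B \<subseteq> p" "infinite B" "\<And>u v m. u \<in> B \<Longrightarrow> v \<in> B \<Longrightarrow> u < v \<Longrightarrow> m \<le> u \<Longrightarrow> g m \<le> v"
      using thin_subset[of p g] p by blast
    moreover have "almost_subset B p"
      using \<open>B \<subseteq> p\<close> by (simp add: almost_subset_def Diff_eq_empty_iff[THEN iffD2])
    ultimately show "\<exists>q\<in>{B. infinite B} \<inter> E. almost_subset q p"
      unfolding g D_def by blast
  qed (fact almost_subset_refl almost_subset_trans)+
  then obtain B :: "nat set" where B: "infinite B"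
    and meets: "\<forall>A\<in>D ` G. \<exists>p\<in>{B. infinite B} \<inter> A. almost_subset B p"
    by auto
  have BD: "\<exists>A\<in>D g. almost_subset B A" if "g \<in> G" for g
    using bspec[OF meets imageI[OF that]] by auto
  have ex: "\<exists>w. w \<in> B \<and> z < w" for z
    using B unfolding infinite_nat_iff_unbounded by blast
  define nx where "nx z = (SOME w. w \<in> B \<and> z < w)" for z
  have nx: "nx z \<in> B" "z < nx z" for z
    using someI_ex[OF ex[of z]] unfolding nx_def by auto
  show thesis
  proof
    fix g assume "g \<in> G"
    then obtain A where A: "A \<in> D g" "almost_subset B A"
      using BD by blast
    then obtain k where k: "\<And>w. w \<in> B - A \<Longrightarrow> w \<le> k"
      unfolding almost_subset_def finite_nat_set_iff_bounded_le by blast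
    \<comment> \<open>Beyond \<open>k\<close> both \<open>nx n\<close> and \<open>nx (nx n)\<close>
      lie in \<open>A\<close>, and the second bounds \<open>g\<close> on all arguments up to the
      first, in particular at \<open>n\<close>.\<close>
    have "g n \<le> nx (nx n)" if "n \<ge> k" for n
    proof -
      have "nx n \<in> A" "nx (nx n) \<in> A"
      proof -
        have "k < nx n" "k < nx (nx n)"
          using nx(2)[of n] nx(2)[of "nx n"] that by linarith+
        then show "nx n \<in> A" "nx (nx n) \<in> A"
          using k nx(1) by (meson DiffI leD)+
      qed
      then show ?thesis
        using A(1) nx(2)[of "nx n"] less_imp_le[OF nx(2)[of n]] unfolding D_def by blast
    qed
    then show "\<exists>k. \<forall>n\<ge>k. g n \<le> nx (nx n)"
      by blast
  qed
qed

section \<open>Binary strings and generic branches\<close>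

definition pre :: "nat set \<Rightarrow> nat \<Rightarrow> bool list" where
  "pre x k = map (\<lambda>i. i \<in> x) [0..<k]"

definition ext :: "bool list \<Rightarrow> bool list set" where
  "ext s = range (append s)"

definition dense_strings :: "bool list set \<Rightarrow> bool" where
  "dense_strings D \<longleftrightarrow> (\<forall>s. \<exists>t. s @ t \<in> D)"

definition meets :: "nat set \<Rightarrow> bool list set \<Rightarrow> bool" where
  "meets x D \<longleftrightarrow> (\<exists>k. pre x k \<in> D)"

lemma length_pre [simp]: "length (pre x k) = k"
  by (simp add: pre_def)

lemma pre_nth [simp]: "i < k \<Longrightarrow> pre x k ! i \<longleftrightarrow> i \<in> x"
  by (simp add: pre_def)

lemma take_pre: "l \<le> k \<Longrightarrow> take l (pre x k) = pre x l"
  by (simp add: pre_def take_map)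

lemma pre_append: "l \<le> k \<Longrightarrow> \<exists>t. pre x k = pre x l @ t"
  by (metis take_pre append_take_drop_id)

lemma ext_iff: "t \<in> ext s \<longleftrightarrow> (\<exists>u. t = s @ u)"
  by (auto simp: ext_def)

lemma infinite_ext: "infinite (ext s)"
proof -
  have "inj (append s)"
    by (auto intro: injI)
  then show ?thesis
    unfolding ext_def by (simp add: finite_image_iff infinite_UNIV_listI)
qed

lemma ext_append_subset: "ext (s @ t) \<subseteq> ext s"
  by (auto simp: ext_def)

lemma tower_pseudo_intersection_strings:
  fixes a :: "nat set \<Rightarrow> bool list set" and r :: "nat set rel"
  assumes t: "t_eq_c" and r: "Well_order r" "small (Field r)"
    and inf: "\<And>i. i \<in> Field r \<Longrightarrow> infinite (a i)"
    and dec: "\<And>i j. (i, j) \<in> r \<Longrightarrow> finite (a j - a i)"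
  shows "\<exists>b. infinite b \<and> (\<forall>i\<in>Field r. finite (b - a i))"
proof -
  define c :: "bool list \<Rightarrow> nat" where "c = to_nat_on UNIV"
  have c: "bij c"
    unfolding c_def by (rule to_nat_on_infinite) (auto simp: infinite_UNIV_listI)
  have diff: "c ` A - c ` B = c ` (A - B)" for A B
    using c by (simp add: image_set_diff bij_def)
  have fin: "finite (c ` A) \<longleftrightarrow> finite A" for A
    using c by (meson bij_is_inj finite_image_iff inj_on_subset subset_UNIV)
  have "\<exists>b. infinite b \<and> (\<forall>i\<in>Field r. almost_subset b (c ` a i))"
    by (rule tower_pseudo_intersection[OF t r]) (auto simp: fin inf almost_subset_def diff dec)
  then obtain b where b: "infinite b" "\<forall>i\<in>Field r. almost_subset b (c ` a i)"
    by blast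
  have cb: "c ` (c -` b) = b"
    using c by (simp add: bij_is_surj)
  show ?thesis
  proof (intro exI[of _ "c -` b"] conjI ballI)
    show "infinite (c -` b)"
      using b(1) cb fin by metis
    show "finite (c -` b - a i)" if "i \<in> Field r" for i
      using b(2) that cb fin diff unfolding almost_subset_def by metis
  qed
qed

text \<open>Thickness survives intersection with the upward closure of a dense set, and it lets a
  branch be continued into the set from any node.\<close>

definition thick :: "bool list set set" where
  "thick = {A. \<forall>s. infinite (A \<inter> ext s)}"

text \<open>A pseudo-intersection is taken above each string \<open>s\<close> separately. Each piece
  \<open>b s\<close> has a finite error against \<open>a i\<close>, but the union of all pieces may
  have an infinite one. The errors against \<open>a i\<close> are bounded by a function of
  \<open>s\<close>; a function dominating all these bounds tells how much to delete from each
  piece.\<close>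

lemma thick_tower_lower_bound:
  fixes a :: "nat set \<Rightarrow> bool list set" and r :: "nat set rel"
  assumes t: "t_eq_c" and r: "Well_order r" "small (Field r)"
    and thick: "\<And>i. i \<in> Field r \<Longrightarrow> a i \<in> thick"
    and dec: "\<And>i j. (i, j) \<in> r \<Longrightarrow> finite (a j - a i)"
  shows "\<exists>b\<in>thick. \<forall>i\<in>Field r. finite (b - a i)"
proof (cases "Field r = {}")
  case True
  have "UNIV \<in> thick"
    by (auto simp: thick_def infinite_ext)
  then show ?thesis
    using True by auto
next
  case False
  have "\<exists>b. infinite b \<and> (\<forall>i\<in>Field r. finite (b - a i \<inter> ext s))" for s
  proof (rule tower_pseudo_intersection_strings[OF t r])
    show "infinite (a i \<inter> ext s)" if "i \<in> Field r" for i
      using thick[OF that] unfolding thick_def by auto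
    show "finite (a j \<inter> ext s - a i \<inter> ext s)" if "(i, j) \<in> r" for i j
      by (rule finite_subset[OF _ dec[OF that]]) auto
  qed
  then obtain b where b: "\<And>s. infinite (b s)" "\<And>s i. i \<in> Field r \<Longrightarrow> finite (b s - a i \<inter> ext s)"
    by metis
  define enc :: "bool list \<Rightarrow> nat" where "enc = to_nat"
  have enc: "inj enc"
    by (simp add: enc_def)
  have fin_enc: "finite {u. enc u \<le> n}" for n
    using finite_vimageI[of "{..n}" enc] enc by (auto simp: vimage_def)
  \<comment> \<open>A bound for the codes of the errors of \<open>b s\<close> against
    \<open>a i\<close>, where \<open>n\<close> codes \<open>s\<close>; inserting \<open>0\<close>
    covers the case of no error.\<close>
  define g where "g i n = Max (insert 0 (enc ` (b (from_nat n) - a i \<inter> ext (from_nat n))))" for i n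
  have g: "enc u \<le> g i (enc s)" if "i \<in> Field r" "u \<in> b s - a i \<inter> ext s" for i s u
    using that b(2)[OF that(1), of s] unfolding g_def enc_def by (auto intro!: Max_ge)
  obtain F where F: "\<And>h. h \<in> g ` Field r \<Longrightarrow> \<exists>k. \<forall>n\<ge>k. h n \<le> F n"
    using small_family_dominated[OF t small_image[OF r(2), of g]] by blast
  \<comment> \<open>Only finitely many strings are deleted from each piece, so thickness is
    kept.\<close>
  define B where "B = (\<Union>s. {u \<in> b s \<inter> ext s. F (enc s) < enc u})"
  have "B \<in> thick"
    unfolding thick_def
  proof (intro CollectI allI)
    fix s
    obtain i where i: "i \<in> Field r"
      using False by blast
    have "finite (b s - ext s)"
      by (rule finite_subset[OF _ b(2)[OF i, of s]]) auto
    then have "infinite (b s \<inter> ext s)"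
      using b(1)[of s] by (metis Int_Diff_Un finite_Un)
    moreover have "b s \<inter> ext s \<subseteq> (B \<inter> ext s) \<union> {u. enc u \<le> F (enc s)}"
      unfolding B_def by auto
    ultimately show "infinite (B \<inter> ext s)"
      using fin_enc finite_subset by (metis finite_Un)
  qed
  moreover have "finite (B - a i)" if i: "i \<in> Field r" for i
  proof -
    obtain k where k: "\<And>n. n \<ge> k \<Longrightarrow> g i n \<le> F n"
      using F[of "g i"] i by blast
    \<comment> \<open>Once the code of \<open>s\<close> reaches \<open>k\<close>, all errors of the
      piece \<open>b s\<close> have been deleted; finitely many pieces remain.\<close>
    have "B - a i \<subseteq> (\<Union>s\<in>{s. enc s \<le> k}. b s - a i \<inter> ext s)"
    proof
      fix u assume u: "u \<in> B - a i"
      then obtain s where s: "u \<in> b s" "u \<in> ext s" "F (enc s) < enc u"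
        unfolding B_def by blast
      then have "enc u \<le> g i (enc s)"
        using g[OF i, of u s] u by auto
      then have "\<not> enc s \<ge> k"
        using k[of "enc s"] s(3) by linarith
      then show "u \<in> (\<Union>s\<in>{s. enc s \<le> k}. b s - a i \<inter> ext s)"
        using s u by (intro UN_I[of s]) auto
    qed
    then show ?thesis
      using fin_enc b(2)[OF i] by (meson finite_UN_I finite_subset)
  qed
  ultimately show ?thesis
    by blast
qed

lemma chain_union_pre:
  assumes "\<And>k. \<exists>t. s (Suc k) = s k @ t"
  defines "x \<equiv> {i. \<exists>k. i < length (s k) \<and> s k ! i}"
  shows "pre x (length (s k)) = s k"
proof -
  have le: "\<exists>t. s (k + d) = s k @ t" for k d
  proof (induction d)
    case (Suc d)
    then show ?case
      using assms(1)[of "k + d"] by auto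
  qed simp
  have agree: "s k ! i = s l ! i" if "i < length (s k)" "i < length (s l)" for k l i
  proof (cases "k \<le> l")
    case True
    then show ?thesis
      using le[of k "l - k"] that by (auto simp: nth_append)
  next
    case False
    then show ?thesis
      using le[of l "k - l"] that by (auto simp: nth_append)
  qed
  have "i \<in> x \<longleftrightarrow> s k ! i" if "i < length (s k)" for i
    unfolding x_def using agree[OF that] that by blast
  then show ?thesis
    by (intro nth_equalityI) simp_all
qed

text \<open>This is \<open>\<t> \<le> cov(\<M>)\<close>: a thick set of strings almost contained in every dense set is
  obtained from a tower of thick sets, and any branch through infinitely many of its members
  meets all the dense sets.\<close>

lemma small_dense_family_met:
  assumes t: "t_eq_c" and small: "small \<D>" and dense: "\<And>D. D \<in> \<D> \<Longrightarrow> dense_strings D"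
  obtains x where "pre x (length s) = s" "\<And>D. D \<in> \<D> \<Longrightarrow> meets x D"
proof -
  \<comment> \<open>Upward closure makes intersections with thick sets thick again, and a branch
    through a string in \<open>up D\<close> has already passed through \<open>D\<close>.\<close>
  define up where "up D = (\<Union>s\<in>D. ext s)" for D
  have "\<exists>q\<in>thick. \<forall>A\<in>(\<lambda>D. Pow (up D)) ` \<D>. \<exists>p\<in>thick \<inter> A. finite (q - p)"
  proof (rule closed_preorder_meets_dense[where le = "\<lambda>p q. finite (p - q)"])
    show "finite (p - r)" if "finite (p - q)" "finite (q - r)" for p q r :: "bool list set"
      by (rule finite_subset[of _ "(p - q) \<union> (q - r)"]) (use that in auto)
    show "\<exists>q\<in>thick. \<forall>i\<in>Field r. finite (q - p i)"
      if "Well_order r" "small (Field r)" "\<And>i. i \<in> Field r \<Longrightarrow> p i \<in> thick"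
        "\<And>i j. (i, j) \<in> r \<Longrightarrow> finite (p j - p i)" for r :: "nat set rel" and p
      using thick_tower_lower_bound[OF t that] .
    show "small ((\<lambda>D. Pow (up D)) ` \<D>)"
      by (rule small_image[OF small])
    fix E and p :: "bool list set"
    assume "E \<in> (\<lambda>D. Pow (up D)) ` \<D>" and p: "p \<in> thick"
    then obtain D where D: "D \<in> \<D>" "E = Pow (up D)"
      by blast
    have "infinite (p \<inter> up D \<inter> ext s)" for s
    proof -
      obtain u where u: "s @ u \<in> D"
        using dense[OF D(1)] unfolding dense_strings_def by blast
      then have "p \<inter> ext (s @ u) \<subseteq> p \<inter> up D \<inter> ext s"
        using ext_append_subset unfolding up_def by blast
      moreover have "infinite (p \<inter> ext (s @ u))"
        using p unfolding thick_def by blast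
      ultimately show ?thesis
        using finite_subset by blast
    qed
    then show "\<exists>q\<in>thick \<inter> E. finite (q - p)"
      using D(2) by (intro bexI[of _ "p \<inter> up D"]) (auto simp: thick_def Diff_eq_empty_iff[THEN iffD2])
  qed simp
  then obtain A where A: "A \<in> thick"
    and meets: "\<forall>E\<in>(\<lambda>D. Pow (up D)) ` \<D>. \<exists>p\<in>thick \<inter> E. finite (A - p)"
    by auto
  have AD: "\<exists>B\<subseteq>up D. finite (A - B)" if "D \<in> \<D>" for D
    using bspec[OF meets imageI[OF that]] by auto
  have step: "\<exists>v\<in>A. \<exists>w. w \<noteq> [] \<and> v = u @ w" for u
  proof -
    have "infinite (A \<inter> ext u - {u})"
      using A unfolding thick_def by simp
    then obtain v where "v \<in> A \<inter> ext u - {u}"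
      by (metis finite.emptyI ex_in_conv)
    then show ?thesis
      by (auto simp: ext_def)
  qed
  have "\<exists>\<sigma>. \<forall>k. (\<sigma> (Suc k) \<in> A \<and> (\<exists>w. w \<noteq> [] \<and> \<sigma> (Suc k) = \<sigma> k @ w)) \<and> \<sigma> 0 = s"
  proof -
    have "\<exists>\<sigma>. \<forall>k. (k = 0 \<longrightarrow> \<sigma> k = s) \<and> (\<sigma> (Suc k) \<in> A \<and> (\<exists>w. w \<noteq> [] \<and> \<sigma> (Suc k) = \<sigma> k @ w))"
      by (rule dependent_nat_choice) (use step in auto)
    then show ?thesis
      by blast
  qed
  then obtain \<sigma> where \<sigma>: "\<And>k. \<sigma> (Suc k) \<in> A" "\<And>k. \<exists>w. w \<noteq> [] \<and> \<sigma> (Suc k) = \<sigma> k @ w" "\<sigma> 0 = s"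
    by blast
  define x where "x = {i. \<exists>k. i < length (\<sigma> k) \<and> \<sigma> k ! i}"
  have "\<exists>t. \<sigma> (Suc k) = \<sigma> k @ t" for k
    using \<sigma>(2) by blast
  from chain_union_pre[of \<sigma>, OF this] have x: "pre x (length (\<sigma> k)) = \<sigma> k" for k
    unfolding x_def .
  have "length (\<sigma> k) < length (\<sigma> (Suc k))" for k
    using \<sigma>(2)[of k] by auto
  then have "strict_mono (\<lambda>k. length (\<sigma> k))"
    by (simp add: strict_mono_Suc_iff)
  then have inj: "inj \<sigma>"
    by (metis injI strict_mono_eq)
  show thesis
  proof
    show "pre x (length s) = s"
      using x[of 0] \<sigma>(3) by simp
    fix D assume "D \<in> \<D>"
    then obtain B where B: "B \<subseteq> up D" "finite (A - B)"
      using AD by blast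
    have "infinite (range (\<lambda>k. \<sigma> (Suc k)))"
      using inj by (intro range_inj_infinite) (auto simp: inj_def)
    \<comment> \<open>The branch has infinitely many nodes in \<open>A\<close>, and only finitely
      many elements of \<open>A\<close> are outside \<open>B\<close>.\<close>
    then have "\<not> range (\<lambda>k. \<sigma> (Suc k)) \<subseteq> A - B"
      using B(2) finite_subset by blast
    then obtain k where "\<sigma> (Suc k) \<in> B"
      using \<sigma>(1) by blast
    then obtain d u where "d \<in> D" "\<sigma> (Suc k) = d @ u"
      using B(1) unfolding up_def ext_def by blast
    then have "pre x (length d) = d"
      using x[of "Suc k"] take_pre[of "length d" "length (\<sigma> (Suc k))" x] by simp
    then show "meets x D"
      using \<open>d \<in> D\<close> unfolding meets_def by metis
  qed
qed

section \<open>Comeager sets\<close>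

text \<open>A dense set of strings stands for the dense open union of its cylinders, so this is the
  usual notion: \<open>C\<close> contains an intersection of countably many dense open sets.\<close>

definition comeager :: "nat set set \<Rightarrow> bool" where
  "comeager C \<longleftrightarrow> (\<exists>\<D>. countable \<D> \<and> (\<forall>D\<in>\<D>. dense_strings D) \<and>
     (\<forall>x. (\<forall>D\<in>\<D>. meets x D) \<longrightarrow> x \<in> C))"

text \<open>A small union of countable families of dense sets is small. The prescribed initial
  segment \<open>s\<close> is used later to put \<open>0\<close> into the new point.\<close>

lemma small_comeager_family_met:
  assumes t: "t_eq_c" and small: "small \<C>" and com: "\<And>C. C \<in> \<C> \<Longrightarrow> comeager C"
  obtains x where "pre x (length s) = s" "\<And>C. C \<in> \<C> \<Longrightarrow> x \<in> C"
proof -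
  obtain \<D> where \<D>: "\<And>C. C \<in> \<C> \<Longrightarrow> countable (\<D> C)"
    "\<And>C D. C \<in> \<C> \<Longrightarrow> D \<in> \<D> C \<Longrightarrow> dense_strings D"
    "\<And>C x. C \<in> \<C> \<Longrightarrow> (\<And>D. D \<in> \<D> C \<Longrightarrow> meets x D) \<Longrightarrow> x \<in> C"
    using com unfolding comeager_def by metis
  have "(\<Union>C\<in>\<C>. \<D> C) \<subseteq> (\<lambda>(C, n). from_nat_into (\<D> C) n) ` (\<C> \<times> (UNIV :: nat set))"
  proof
    fix D assume "D \<in> (\<Union>C\<in>\<C>. \<D> C)"
    then obtain C where C: "C \<in> \<C>" "D \<in> \<D> C"
      by blast
    then show "D \<in> (\<lambda>(C, n). from_nat_into (\<D> C) n) ` (\<C> \<times> (UNIV :: nat set))"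
      using from_nat_into_to_nat_on[OF \<D>(1)[OF C(1)] C(2)]
      by (intro image_eqI[of _ _ "(C, to_nat_on (\<D> C) D)"]) auto
  qed
  then have "small (\<Union>C\<in>\<C>. \<D> C)"
    using small_Times[OF small small_nat] small_image small_subset by meson
  moreover have "dense_strings D" if "D \<in> (\<Union>C\<in>\<C>. \<D> C)" for D
    using that \<D>(2) by blast
  ultimately obtain x where x: "pre x (length s) = s" "\<And>D. D \<in> (\<Union>C\<in>\<C>. \<D> C) \<Longrightarrow> meets x D"
    using small_dense_family_met[OF t, of "\<Union>C\<in>\<C>. \<D> C" s] by auto
  show thesis
  proof (rule that[OF x(1)])
    show "x \<in> C" if "C \<in> \<C>" for C
      by (rule \<D>(3)[OF that]) (use x(2) that in blast)
  qed
qed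

section \<open>Borel codes and Cohen forcing\<close>

datatype borel_code = Cyl "bool list" | Neg borel_code | Join "nat \<Rightarrow> borel_code"

primrec borel_set :: "borel_code \<Rightarrow> nat set set" where
  "borel_set (Cyl s) = {x. pre x (length s) = s}"
| "borel_set (Neg c) = - borel_set c"
| "borel_set (Join f) = (\<Union>n. borel_set (f n))"

text \<open>A code is a well-founded tree, identified with its set of (path, label) pairs; hence there
  are only continuum many codes.\<close>

primrec code_tree :: "borel_code \<Rightarrow> (nat list \<times> nat) set" where
  "code_tree (Cyl s) = {([], to_nat s + 2)}"
| "code_tree (Neg c) = insert ([], 0) (apfst (Cons 0) ` code_tree c)"
| "code_tree (Join f) = insert ([], 1) (\<Union>n. apfst (Cons n) ` code_tree (f n))"

lemma code_tree_vimage: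
  "{p. apfst (Cons 0) p \<in> code_tree (Neg c)} = code_tree c"
  "{p. apfst (Cons n) p \<in> code_tree (Join f)} = code_tree (f n)"
  by auto

text \<open>The offset \<open>2\<close> in the label of a cylinder keeps it apart from the labels
  \<open>0\<close> and \<open>1\<close> of the other constructors.\<close>

lemma code_tree_root:
  "([], l) \<in> code_tree (Cyl s) \<longleftrightarrow> l = to_nat s + 2"
  "([], l) \<in> code_tree (Neg c) \<longleftrightarrow> l = 0"
  "([], l) \<in> code_tree (Join f) \<longleftrightarrow> l = 1"
  by auto

lemma code_tree_inject: "code_tree c = code_tree d \<Longrightarrow> c = d"
proof (induction c arbitrary: d)
  case (Cyl s)
  have "([], to_nat s + 2) \<in> code_tree d"
    using Cyl[symmetric] by simp
  then show ?case
    by (cases d) (auto simp: code_tree_root)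
next
  case (Neg c)
  have "([], 0) \<in> code_tree d"
    using Neg.prems[symmetric] by simp
  then obtain d' where "d = Neg d'"
    by (cases d) (auto simp: code_tree_root)
  then show ?case
    using Neg code_tree_vimage(1) by metis
next
  case (Join f)
  have "([], 1) \<in> code_tree d"
    using Join.prems[symmetric] by simp
  then obtain g where g: "d = Join g"
    by (cases d) (auto simp: code_tree_root)
  have "f n = g n" for n
    using Join g code_tree_vimage(2) by (metis rangeI)
  then show ?case
    using g by auto
qed

text \<open>Cohen forcing: \<open>s\<close> forces \<open>c\<close> if every sufficiently generic \<open>x\<close> extending \<open>s\<close> belongs to
  the set coded by \<open>c\<close>. The truth lemma \<open>generic_iff_force\<close> replaces the Baire property.\<close>

primrec force :: "borel_code \<Rightarrow> bool list set" where
  "force (Cyl s) = ext s"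
| "force (Neg c) = {s. \<forall>t. s @ t \<notin> force c}"
| "force (Join f) = (\<Union>n. force (f n))"

lemma force_append: "s \<in> force c \<Longrightarrow> s @ t \<in> force c"
proof (induction c arbitrary: s t)
  case (Join f)
  then obtain n where "s \<in> force (f n)"
    by auto
  then have "s @ t \<in> force (f n)"
    using Join.IH by blast
  then show ?case
    by auto
qed (auto simp: ext_def)

text \<open>What a point has to meet to count as generic for \<open>c\<close>. At each negation
  inside the code, some initial segment must force the negated code or its negation; countable
  branching keeps the requirements countable.\<close>

primrec deciding :: "borel_code \<Rightarrow> bool list set set" where
  "deciding (Cyl s) = {{t. length s \<le> length t}}"
| "deciding (Neg c) = insert (force c \<union> force (Neg c)) (deciding c)"
| "deciding (Join f) = (\<Union>n. deciding (f n))"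

lemma countable_deciding: "countable (deciding c)"
  by (induction c) auto

lemma dense_deciding: "D \<in> deciding c \<Longrightarrow> dense_strings D"
proof (induction c)
  case (Cyl s)
  then show ?case
    by (auto simp: dense_strings_def intro: exI[of _ s])
next
  case (Neg c)
  have "dense_strings (force c \<union> force (Neg c))"
    unfolding dense_strings_def by simp (metis append_Nil2)
  then show ?case
    using Neg by auto
qed auto

lemma generic_iff_force:
  "(\<And>D. D \<in> deciding c \<Longrightarrow> meets x D) \<Longrightarrow> x \<in> borel_set c \<longleftrightarrow> (\<exists>k. pre x k \<in> force c)"
proof (induction c)
  case (Cyl s)
  have "pre x (length s) = s" if "pre x k = s @ u" for k u
    using that take_pre[of "length s" k x] by (metis append_eq_conv_conj length_append length_pre le_add1)
  moreover have "s \<in> ext s"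
    unfolding ext_iff by (rule exI[of _ "[]"]) simp
  ultimately show ?case
    by (auto simp: ext_iff) (metis append_Nil2)
next
  case (Neg c)
  then have IH: "x \<in> borel_set c \<longleftrightarrow> (\<exists>k. pre x k \<in> force c)"
    by simp
  obtain k where k: "pre x k \<in> force c \<or> (\<forall>t. pre x k @ t \<notin> force c)"
    using Neg.prems[of "force c \<union> force (Neg c)"] unfolding meets_def by auto
  \<comment> \<open>Two initial segments of \<open>x\<close> have a common extension, to which
    forcing passes.\<close>
  have "pre x l \<notin> force c" if "\<forall>t. pre x m @ t \<notin> force c" for m l
  proof
    assume l: "pre x l \<in> force c"
    obtain t u where tu: "pre x (max m l) = pre x m @ t" "pre x (max m l) = pre x l @ u"
      using pre_append[of m "max m l" x] pre_append[of l "max m l" x] by auto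
    then show False
      using l that force_append[of _ c u] by metis
  qed
  then show ?case
    using IH k by auto
next
  case (Join f)
  then show ?case
    by (simp add: UN_iff) blast
qed

section \<open>Splitting the trace of a generic point\<close>

text \<open>Finite sets count as split, so that the notion applies to all traces and all
  intersections of them.\<close>

definition splits :: "nat set \<Rightarrow> nat set \<Rightarrow> bool" where
  "splits S Y \<longleftrightarrow> finite Y \<or> (infinite (Y \<inter> S) \<and> infinite (Y - S))"

text \<open>The map \<open>h\<close> belonging to the sequence of Borel sets coded by
  \<open>f\<close>.\<close>

definition code_trace :: "(nat \<Rightarrow> borel_code) \<Rightarrow> nat set \<Rightarrow> nat set" where
  "code_trace f x = {n. x \<in> borel_set (f n)}"

text \<open>An upper bound for the traces of generic points extending \<open>s\<close> which does
  not mention those points, so it can be split before they are chosen.\<close>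

definition possible :: "(nat \<Rightarrow> borel_code) \<Rightarrow> bool list \<Rightarrow> nat set" where
  "possible f s = {n. \<exists>t. s @ t \<in> force (f n)}"

lemma infinite_imp_above: "infinite Y \<Longrightarrow> \<exists>n. n \<in> Y \<and> (m::nat) < n"
  using infinite_nat_iff_unbounded by auto

lemma infinite_if_above: "(\<And>m. \<exists>n. n \<in> Y \<and> (m::nat) < n) \<Longrightarrow> infinite Y"
  using infinite_nat_iff_unbounded by blast

text \<open>If \<open>Z \<inter> possible f s\<close> is finite for some initial segment
  \<open>s\<close> of a generic \<open>x\<close>, then so is
  \<open>Z \<inter> code_trace f x\<close>. Otherwise, above every string, arbitrarily large
  elements of \<open>Z\<close> on either side of \<open>S\<close> can still be forced into the
  trace, and genericity realises infinitely many on both sides.\<close>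

lemma comeager_splits_trace:
  assumes S: "\<And>s. splits S (Z \<inter> possible f s)"
  shows "comeager {x. splits S (Z \<inter> code_trace f x)}"
proof -
  \<comment> \<open>The first disjunct keeps \<open>E m W\<close> dense above strings that leave
    only finitely many values; a generic point with infinite trace in \<open>Z\<close> passes
    through none of them.\<close>
  define E where "E m W = {s. finite (Z \<inter> possible f s) \<or> (\<exists>n>m. n \<in> Z \<inter> W \<and> s \<in> force (f n))}" for m W
  define \<D> where "\<D> = (\<Union>n. deciding (f n)) \<union> range (\<lambda>m. E m S) \<union> range (\<lambda>m. E m (- S))"
  have dense_E: "dense_strings (E m W)"
    if W: "\<And>s. finite (Z \<inter> possible f s) \<or> infinite (Z \<inter> possible f s \<inter> W)" for m W
    unfolding dense_strings_def
  proof
    fix s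
    show "\<exists>t. s @ t \<in> E m W"
    proof (cases "finite (Z \<inter> possible f s)")
      case True
      then show ?thesis
        by (intro exI[of _ "[]"]) (simp add: E_def)
    next
      case False
      then obtain n where "n \<in> Z \<inter> possible f s \<inter> W" "n > m"
        using W infinite_imp_above by blast
      then show ?thesis
        unfolding E_def possible_def by blast
    qed
  qed
  have inf_E: "infinite (Z \<inter> code_trace f x \<inter> W)"
    if x: "\<And>n. x \<in> borel_set (f n) \<longleftrightarrow> (\<exists>k. pre x k \<in> force (f n))"
      and E: "\<And>m. meets x (E m W)" and inf: "infinite (Z \<inter> code_trace f x)" for x W
  proof -
    have "infinite (Z \<inter> possible f (pre x k))" for k
    proof -
      have "code_trace f x \<subseteq> possible f (pre x k)"
      proof
        fix n assume "n \<in> code_trace f x"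
        then obtain l where l: "pre x l \<in> force (f n)"
          using x unfolding code_trace_def by blast
        obtain t u where "pre x (max k l) = pre x k @ t" "pre x (max k l) = pre x l @ u"
          using pre_append[of k "max k l" x] pre_append[of l "max k l" x] by auto
        then have "pre x k @ t \<in> force (f n)"
          using force_append[OF l, of u] by metis
        then show "n \<in> possible f (pre x k)"
          unfolding possible_def by blast
      qed
      then show ?thesis
        using inf by (meson Int_mono finite_subset order_refl)
    qed
    then have "\<exists>n. n \<in> Z \<inter> code_trace f x \<inter> W \<and> m < n" for m
      using E[of m] x unfolding meets_def E_def code_trace_def by auto
    then show ?thesis
      by (rule infinite_if_above)
  qed
  show ?thesis
    unfolding comeager_def
  proof (intro exI[of _ \<D>] conjI allI impI ballI)
    show "countable \<D>"
      unfolding \<D>_def by (auto simp: countable_deciding)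
    show "dense_strings D" if "D \<in> \<D>" for D
    proof -
      have "dense_strings (E m S)" "dense_strings (E m (- S))" for m
        using S by (auto intro!: dense_E simp: splits_def Diff_eq)
      then show ?thesis
        using that dense_deciding unfolding \<D>_def by blast
    qed
    fix x assume x: "\<forall>D\<in>\<D>. meets x D"
    have "x \<in> borel_set (f n) \<longleftrightarrow> (\<exists>k. pre x k \<in> force (f n))" for n
      by (rule generic_iff_force) (use x in \<open>auto simp: \<D>_def\<close>)
    from inf_E[of x, OF this] show "x \<in> {x. splits S (Z \<inter> code_trace f x)}"
      using x unfolding splits_def \<D>_def by (auto simp: Diff_eq)
  qed
qed

section \<open>Translations, and splitting small families\<close>

definition flip :: "nat set \<Rightarrow> bool list \<Rightarrow> bool list" where
  "flip a s = map (\<lambda>i. s ! i \<noteq> (i \<in> a)) [0..<length s]"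

lemma flip_flip: "flip a (flip a s) = s"
  by (rule nth_equalityI) (auto simp: flip_def)

lemma flip_append: "\<exists>u. flip a (s @ t) = flip a s @ u"
proof -
  have "take (length s) (flip a (s @ t)) = flip a s"
    by (rule nth_equalityI) (auto simp: flip_def nth_append)
  then show ?thesis
    using append_take_drop_id[of "length s" "flip a (s @ t)"] by (intro exI) (rule sym, simp)
qed

lemma flip_pre: "flip a (pre x k) = pre (sym_diff x a) k"
  by (rule nth_equalityI) (auto simp: flip_def)

text \<open>Translation by \<open>a\<close> acts on strings by \<open>flip a\<close>, an involution
  compatible with extension, so preimages of dense sets of strings are dense.\<close>

lemma comeager_sym_diff:
  assumes "comeager C"
  shows "comeager {x. sym_diff x a \<in> C}"
proof -
  obtain \<D> where \<D>: "countable \<D>" "\<forall>D\<in>\<D>. dense_strings D"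
    "\<forall>x. (\<forall>D\<in>\<D>. meets x D) \<longrightarrow> x \<in> C"
    using assms unfolding comeager_def by auto
  show ?thesis
    unfolding comeager_def
  proof (intro exI[of _ "(\<lambda>D. flip a -` D) ` \<D>"] conjI allI impI ballI)
    show "countable ((\<lambda>D. flip a -` D) ` \<D>)"
      using \<D>(1) by simp
    show "dense_strings D" if "D \<in> (\<lambda>D. flip a -` D) ` \<D>" for D
    proof -
      from that obtain D' where D': "D = flip a -` D'" "D' \<in> \<D>"
        by (rule imageE)
      have "\<exists>t. s @ t \<in> D" for s
      proof -
        obtain t where "flip a s @ t \<in> D'"
          using \<D>(2) D'(2) unfolding dense_strings_def by blast
        moreover obtain u where "flip a (flip a s @ t) = flip a (flip a s) @ u"
          using flip_append by blast
        then have "flip a (s @ u) = flip a s @ t"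
          using flip_flip[of a "flip a s @ t"] by (simp add: flip_flip)
        ultimately have "flip a (s @ u) \<in> D'"
          by simp
        then show ?thesis
          using D'(1) by blast
      qed
      then show ?thesis
        unfolding dense_strings_def by blast
    qed
    fix x assume "\<forall>D\<in>(\<lambda>D. flip a -` D) ` \<D>. meets x D"
    then have "meets (sym_diff x a) D" if "D \<in> \<D>" for D
      using that by (auto simp: meets_def flip_pre)
    then show "x \<in> {x. sym_diff x a \<in> C}"
      using \<D>(3) by simp
  qed
qed

lemma comeager_splits:
  assumes "infinite Y"
  shows "comeager {x. splits x Y}"
proof -
  define E where "E m b = {s. \<exists>n>m. n \<in> Y \<and> n < length s \<and> s ! n = b}" for m and b :: bool
  have dense_E: "dense_strings (E m b)" for m b
    unfolding dense_strings_def
  proof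
    fix s :: "bool list"
    obtain n where n: "n \<in> Y" "n > m + length s"
      using infinite_imp_above[OF assms] by blast
    have "s @ replicate (n - length s) b @ [b] \<in> E m b"
      unfolding E_def using n by (intro CollectI exI[of _ n]) (auto simp: nth_append)
    then show "\<exists>t. s @ t \<in> E m b" ..
  qed
  show ?thesis
    unfolding comeager_def
  proof (intro exI[of _ "range (\<lambda>(m, b). E m b)"] conjI allI impI ballI)
    show "dense_strings D" if "D \<in> range (\<lambda>(m, b). E m b)" for D
      using that dense_E by auto
    fix x assume "\<forall>D\<in>range (\<lambda>(m, b). E m b). meets x D"
    then have E: "meets x (E m b)" for m b
      by auto
    have "\<exists>n. n \<in> Y \<inter> x \<and> m < n" "\<exists>n. n \<in> Y - x \<and> m < n" for m
      using E[of m True] E[of m False] by (auto simp: E_def meets_def)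
    then show "x \<in> {x. splits x Y}"
      using infinite_if_above unfolding splits_def by blast
  qed auto
qed

text \<open>This is \<open>\<t> \<le> \<r>\<close>, obtained from \<open>\<t> \<le> cov(\<M>)\<close>.\<close>

lemma small_family_split:
  assumes t: "t_eq_c" and small: "small \<Y>"
  obtains S where "\<And>Y. Y \<in> \<Y> \<Longrightarrow> splits S Y"
proof -
  have "comeager C" if "C \<in> (\<lambda>Y. {x. splits x Y}) ` \<Y>" for C
  proof -
    from that obtain Y where Y: "C = {x. splits x Y}"
      by (rule imageE)
    show ?thesis
    proof (cases "finite Y")
      case True
      then have "C = UNIV"
        using Y by (simp add: splits_def)
      then show ?thesis
        unfolding comeager_def by (auto intro: exI[of _ "{}"])
    qed (simp add: Y comeager_splits)
  qed
  then obtain S where S: "\<And>C. C \<in> (\<lambda>Y. {x. splits x Y}) ` \<Y> \<Longrightarrow> S \<in> C"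
    using small_comeager_family_met[OF t small_image[OF small], of "\<lambda>Y. {x. splits x Y}" "[]"]
    by metis
  show thesis
    by (rule that[of S]) (use S[OF imageI] in simp)
qed

section \<open>The tower of generic pairs\<close>

text \<open>The tasks of the recursion: a sequence of Borel codes whose traces are to be split, a
  set to be decided, and a pair of numbers to be separated. A task is packed into one set of
  numbers, so all tasks are enumerated by \<open>nat set\<close>.\<close>

lemma surj_nat_set_coding:
  obtains T :: "nat set \<Rightarrow> (nat \<Rightarrow> borel_code) \<times> nat set \<times> nat \<times> nat" where "surj T"
proof -
  \<comment> \<open>The sequence \<open>f\<close> is stored as the tree of \<open>Join f\<close>,
    which determines it.\<close>
  define slices :: "(nat \<Rightarrow> borel_code) \<times> nat set \<times> nat \<times> nat \<Rightarrow> nat \<Rightarrow> nat set"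
    where "slices = (\<lambda>(f, b, n, m) k.
      if k = 0 then to_nat ` code_tree (Join f) else if k = 1 then b else if k = 2 then {n} else {m})"
  define J where "J p = {z. snd (prod_decode z) \<in> slices p (fst (prod_decode z))}" for p
  have "inj J"
  proof (rule injI)
    fix p q assume J: "J p = J q"
    have "prod_encode (k, l) \<in> J p \<longleftrightarrow> l \<in> slices p k" for p k l
      by (simp add: J_def)
    then have sl: "slices p k = slices q k" for k
      using J by blast
    obtain f b n m f' b' n' m' where pq: "p = (f, b, n, m)" "q = (f', b', n', m')"
      by (cases p, cases q) auto
    have "code_tree (Join f) = code_tree (Join f')"
      using sl[of 0] unfolding pq slices_def by (simp add: inj_image_eq_iff del: code_tree.simps)
    then have "f = f'"
      using code_tree_inject by blast
    then show "p = q"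
      using sl[of 1] sl[of 2] sl[of 3] unfolding pq slices_def by simp
  qed
  then show thesis
    using that inj_imp_surj_inv by blast
qed

section \<open>Persistence of splitting sets\<close>

definition meet_traces :: "(nat \<Rightarrow> borel_code) \<Rightarrow> nat set set \<Rightarrow> bool list set \<Rightarrow> nat set" where
  "meet_traces f F A = (\<Inter>x\<in>F. code_trace f x) \<inter> (\<Inter>s\<in>A. possible f s)"

text \<open>Including the sets \<open>possible f s\<close> makes the property persist when generic points are added,
  by \<open>comeager_splits_trace\<close>.\<close>

definition splits_traces :: "(nat \<Rightarrow> borel_code) \<Rightarrow> nat set \<Rightarrow> nat set set \<Rightarrow> bool" where
  "splits_traces f S X \<longleftrightarrow> (\<forall>F\<in>Fpow X. \<forall>A\<in>Fpow UNIV. splits S (meet_traces f F A))"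

lemma splits_traces_mono: "splits_traces f S Y \<Longrightarrow> X \<subseteq> Y \<Longrightarrow> splits_traces f S X"
  using Fpow_mono[of X Y] unfolding splits_traces_def by blast

text \<open>Each requirement involves finitely many points only. This carries the property through
  limit stages and to the final sets.\<close>

lemma splits_traces_chain:
  assumes "\<And>F. finite F \<Longrightarrow> F \<subseteq> X \<Longrightarrow> \<exists>Y. F \<subseteq> Y \<and> splits_traces f S Y"
  shows "splits_traces f S X"
  unfolding splits_traces_def
proof
  fix F assume "F \<in> Fpow X"
  then have "finite F" "F \<subseteq> X"
    by (auto simp: Fpow_def)
  then obtain Y where "F \<subseteq> Y" "splits_traces f S Y"
    using assms by blast
  then show "\<forall>A\<in>Fpow UNIV. splits S (meet_traces f F A)"
    using \<open>finite F\<close> unfolding splits_traces_def by (auto simp: Fpow_def)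
qed

lemma small_Fpow_strings: "small (Fpow (UNIV :: bool list set))"
  by (intro small_Fpow small_countable) simp

text \<open>A small set of points yields only a small family of meets, which one set splits.\<close>

lemma ex_splits_traces:
  assumes "t_eq_c" "small X"
  obtains S where "splits_traces f S X"
proof -
  have "small ((\<lambda>(F, A). meet_traces f F A) ` (Fpow X \<times> Fpow UNIV))"
    by (intro small_image small_Times small_Fpow small_Fpow_strings assms(2))
  then obtain S where S: "\<And>Y. Y \<in> (\<lambda>(F, A). meet_traces f F A) ` (Fpow X \<times> Fpow UNIV) \<Longrightarrow> splits S Y"
    using small_family_split[OF assms(1)] by metis
  have "splits_traces f S X"
    unfolding splits_traces_def
  proof (intro ballI)
    fix F A assume "F \<in> Fpow X" "A \<in> Fpow (UNIV :: bool list set)"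
    then show "splits S (meet_traces f F A)"
      by (intro S image_eqI[of _ _ "(F, A)"]) auto
  qed
  then show thesis ..
qed

lemma comeager_splits_meet_traces:
  assumes "splits_traces f S X" "F \<in> Fpow X" "A \<in> Fpow UNIV"
  shows "comeager {x. splits S (meet_traces f F A \<inter> code_trace f x)}"
proof (rule comeager_splits_trace)
  fix s
  have "meet_traces f F A \<inter> possible f s = meet_traces f F (insert s A)"
    unfolding meet_traces_def by auto
  moreover have "insert s A \<in> Fpow UNIV"
    using assms(3) by (simp add: Fpow_def)
  ultimately show "splits S (meet_traces f F A \<inter> possible f s)"
    using assms(1,2) unfolding splits_traces_def by simp
qed

lemma splits_traces_insert:
  assumes X: "splits_traces f S X"
    and x: "\<And>F A. F \<in> Fpow X \<Longrightarrow> A \<in> Fpow UNIV \<Longrightarrow> splits S (meet_traces f F A \<inter> code_trace f x)"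
  shows "splits_traces f S (insert x X)"
  unfolding splits_traces_def
proof (intro ballI)
  fix F A assume F: "F \<in> Fpow (insert x X)" and A: "A \<in> Fpow (UNIV :: bool list set)"
  show "splits S (meet_traces f F A)"
  proof (cases "x \<in> F")
    case True
    have "F - {x} \<in> Fpow X"
      using F by (auto simp: Fpow_def)
    moreover have "meet_traces f F A = meet_traces f (F - {x}) A \<inter> code_trace f x"
      using True unfolding meet_traces_def by auto
    ultimately show ?thesis
      using x[of "F - {x}" A] A by simp
  next
    case False
    then have "F \<in> Fpow X"
      using F by (auto simp: Fpow_def)
    then show ?thesis
      using X A unfolding splits_traces_def by blast
  qed
qed

text \<open>All requirements on \<open>x\<close> and on its translate are comeager conditions on
  \<open>x\<close>, and there are few of them. The point is tested against \<open>X\<close> and its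
  translate against \<open>Y\<close>; meets across the two families are not considered.\<close>

lemma ex_generic_pair:
  assumes t: "t_eq_c" and small: "small \<G>" "small X" "small Y"
    and good: "\<And>f S. (f, S) \<in> \<G> \<Longrightarrow> splits_traces f S X \<and> splits_traces f S Y"
    and a: "infinite a"
  obtains x where "0 \<in> x" "splits x a"
    "\<And>f S. (f, S) \<in> \<G> \<Longrightarrow> splits_traces f S (insert x X)"
    "\<And>f S. (f, S) \<in> \<G> \<Longrightarrow> splits_traces f S (insert (sym_diff x a) Y)"
proof -
  define C1 where "C1 = (\<lambda>((f, S), F, A). {x. splits S (meet_traces f F A \<inter> code_trace f x)})"
  define C2 where "C2 = (\<lambda>((f, S), F, A). {x. sym_diff x a \<in> {x. splits S (meet_traces f F A \<inter> code_trace f x)}})"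
  define \<C> where "\<C> = {{x. splits x a}} \<union> C1 ` (\<G> \<times> Fpow X \<times> Fpow UNIV) \<union> C2 ` (\<G> \<times> Fpow Y \<times> Fpow UNIV)"
  have "small \<C>"
    unfolding \<C>_def
    by (intro small_Un small_image small_Times small_Fpow small_Fpow_strings small small_countable) simp
  moreover have "comeager C" if C: "C \<in> \<C>" for C
  proof -
    consider "C = {x. splits x a}"
      | f S F A where "C = C1 ((f, S), F, A)" "(f, S) \<in> \<G>" "F \<in> Fpow X" "A \<in> Fpow UNIV"
      | f S F A where "C = C2 ((f, S), F, A)" "(f, S) \<in> \<G>" "F \<in> Fpow Y" "A \<in> Fpow UNIV"
      using C unfolding \<C>_def by auto
    then show ?thesis
    proof cases
      case 1
      then show ?thesis
        using comeager_splits[OF a] by simp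
    next
      case 2
      then show ?thesis
        unfolding C1_def using comeager_splits_meet_traces[of f S X F A] good by simp
    next
      case 3
      then show ?thesis
        unfolding C2_def
        using comeager_sym_diff[OF comeager_splits_meet_traces[of f S Y F A]] good by simp
    qed
  qed
  \<comment> \<open>The initial segment \<open>[True]\<close> says \<open>0 \<in> x\<close>.\<close>
  ultimately obtain x where x: "pre x (length [True]) = [True]" "\<And>C. C \<in> \<C> \<Longrightarrow> x \<in> C"
    using small_comeager_family_met[OF t, of \<C> "[True]"] by metis
  have X: "splits S (meet_traces f F A \<inter> code_trace f x)"
    if "(f, S) \<in> \<G>" "F \<in> Fpow X" "A \<in> Fpow UNIV" for f S F A
  proof -
    have "C1 ((f, S), F, A) \<in> \<C>"
      using that unfolding \<C>_def by blast
    from x(2)[OF this] show ?thesis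
      unfolding C1_def by simp
  qed
  have Y: "splits S (meet_traces f F A \<inter> code_trace f (sym_diff x a))"
    if "(f, S) \<in> \<G>" "F \<in> Fpow Y" "A \<in> Fpow UNIV" for f S F A
  proof -
    have "C2 ((f, S), F, A) \<in> \<C>"
      using that unfolding \<C>_def by blast
    from x(2)[OF this] show ?thesis
      unfolding C2_def by simp
  qed
  show thesis
  proof (rule that)
    have "pre x 1 ! 0"
      using x(1) by simp
    then show "0 \<in> x"
      by (simp add: pre_def)
    have "{x. splits x a} \<in> \<C>"
      unfolding \<C>_def by blast
    from x(2)[OF this] show "splits x a"
      by simp
    fix f S assume fS: "(f, S) \<in> \<G>"
    show "splits_traces f S (insert x X)"
      by (rule splits_traces_insert) (use good[OF fS] X[OF fS] in auto)
    show "splits_traces f S (insert (sym_diff x a) Y)"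
      by (rule splits_traces_insert) (use good[OF fS] Y[OF fS] in auto)
  qed
qed

lemma Well_order_finite_max:
  assumes "Well_order r" "finite I" "I \<noteq> {}" "I \<subseteq> Field r"
  shows "\<exists>k\<in>I. \<forall>l\<in>I. (l, k) \<in> r"
  using assms(2-4)
proof (induction I rule: finite_ne_induct)
  case (singleton i)
  then show ?case
    using assms(1) by (auto simp: order_on_defs refl_on_def)
next
  case (insert i I)
  then obtain k where k: "k \<in> I" "\<forall>l\<in>I. (l, k) \<in> r"
    by auto
  have tr: "trans r" and re: "(i, i) \<in> r" and tot: "(i, k) \<in> r \<or> (k, i) \<in> r"
    using assms(1) insert.prems insert.hyps(3) k(1) by (auto simp: order_on_defs refl_on_def total_on_def)
  show ?case
  proof (cases "(i, k) \<in> r")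
    case False
    then have "(k, i) \<in> r"
      using tot by blast
    then have "\<forall>l\<in>I. (l, i) \<in> r"
      using k(2) tr by (meson transD)
    then show ?thesis
      using re by blast
  qed (use k in auto)
qed

section \<open>The transfinite recursion\<close>

text \<open>A well-order of least possible type, so that all its proper initial segments are
  small.\<close>

definition cord :: "nat set rel" where
  "cord = card_of UNIV"

lemma cord_Well_order: "Well_order cord"
  unfolding cord_def by (rule card_of_Well_order)

lemma cord_Field: "Field cord = UNIV"
  unfolding cord_def by (rule Field_card_of)

lemma cord_refl: "(i, i) \<in> cord"
  and cord_total: "(i, j) \<in> cord \<or> (j, i) \<in> cord"
  and cord_trans: "(i, j) \<in> cord \<Longrightarrow> (j, k) \<in> cord \<Longrightarrow> (i, k) \<in> cord"
proof -
  have wo: "trans cord" "refl_on UNIV cord" "total_on UNIV cord"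
    using cord_Well_order by (auto simp: order_on_defs cord_Field)
  show "(i, i) \<in> cord" "(i, j) \<in> cord \<or> (j, i) \<in> cord"
    using wo(2,3) by (cases "i = j"; auto simp: refl_on_def total_on_def)+
  show "(i, j) \<in> cord \<Longrightarrow> (j, k) \<in> cord \<Longrightarrow> (i, k) \<in> cord"
    using wo(1) by (rule transD)
qed

lemma small_underS_cord: "small (underS cord i)"
proof -
  have "(card_of (underS cord i), cord) \<in> ordLess"
    by (rule card_of_underS) (simp_all add: cord_Field, simp add: cord_def card_of_card_order_on)
  then show ?thesis
    unfolding small_def by (simp add: cord_def)
qed

text \<open>One stage of the recursion: \<open>X\<close>, \<open>Y\<close> and \<open>\<G>\<close> collect the points and splitting sets chosen
  before, and \<open>a\<close> is almost contained in the tower built so far.\<close>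

lemma ex_next_stage:
  fixes n m :: nat
  assumes t: "t_eq_c" and small: "small \<G>" "small X" "small Y"
    and good: "\<And>f S. (f, S) \<in> \<G> \<Longrightarrow> splits_traces f S X \<and> splits_traces f S Y"
    and a: "infinite a"
  obtains x y S where "0 \<in> x" "0 \<notin> y" "infinite (x - y)" "infinite y"
    "almost_subset (sym_diff x y) a"
    "finite (sym_diff x y \<inter> b) \<or> almost_subset (sym_diff x y) b"
    "n \<noteq> m \<Longrightarrow> m \<noteq> 0 \<Longrightarrow> n \<in> sym_diff x y \<and> m \<notin> sym_diff x y"
    "\<And>g R. (g, R) \<in> insert (f, S) \<G> \<Longrightarrow>
      splits_traces g R (insert x X) \<and> splits_traces g R (insert y Y)"
proof -
  \<comment> \<open>One set for both families; this later gives the splitting of large covers of the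
    union.\<close>
  obtain S where S: "splits_traces f S (X \<union> Y)"
    using ex_splits_traces[OF t small_Un[OF small(2,3)]] by blast
  \<comment> \<open>\<open>a1\<close> decides \<open>b\<close>. The finite change to
    \<open>a2\<close> separates \<open>n\<close> from \<open>m\<close> and inserts \<open>0\<close>,
    so that \<open>0 \<in> x\<close> implies \<open>0 \<notin> y\<close>; hence the condition
    \<open>m \<noteq> 0\<close>.\<close>
  define a1 where "a1 = (if finite (a \<inter> b) then a - b else a \<inter> b)"
  define a2 where "a2 = (a1 - {m}) \<union> {0} \<union> (if n \<noteq> m then {n} else {})"
  have a1: "infinite a1"
    using a Int_Diff_Un[of a b] unfolding a1_def by (metis finite_Un)
  have a2: "infinite a2"
    using a1 unfolding a2_def by simp
  have a2_a1: "a2 \<subseteq> a1 \<union> {0, n}"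
    unfolding a2_def by auto
  have sG: "small (insert (f, S) \<G>)"
    using small_Un[OF small_countable small(1), of "{(f, S)}"] by simp
  have goodG: "splits_traces g R X \<and> splits_traces g R Y" if "(g, R) \<in> insert (f, S) \<G>" for g R
    using that good S splits_traces_mono[of f S "X \<union> Y"] by auto
  obtain x where x: "0 \<in> x" "splits x a2"
    "\<And>g R. (g, R) \<in> insert (f, S) \<G> \<Longrightarrow> splits_traces g R (insert x X)"
    "\<And>g R. (g, R) \<in> insert (f, S) \<G> \<Longrightarrow> splits_traces g R (insert (sym_diff x a2) Y)"
    using ex_generic_pair[OF t sG small(2,3) goodG a2] by metis
  define y where "y = sym_diff x a2"
  have sd: "sym_diff x y = a2"
    unfolding y_def by auto
  show thesis
  proof (rule that)
    show "0 \<in> x"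
      by (rule x(1))
    show "0 \<notin> y"
      using x(1) unfolding y_def a2_def by auto
    \<comment> \<open>\<open>x\<close> splits \<open>a2\<close>: the half inside \<open>x\<close> is
      \<open>x - y\<close>, and the half outside lies in \<open>y\<close>.\<close>
    have "x - y = a2 \<inter> x"
      unfolding y_def by auto
    then show "infinite (x - y)"
      using x(2) a2 unfolding splits_def by simp
    have "a2 - x \<subseteq> y"
      unfolding y_def by auto
    then show "infinite y"
      using x(2) a2 finite_subset unfolding splits_def by blast
    show "almost_subset (sym_diff x y) a"
      unfolding sd almost_subset_def
      by (rule finite_subset[of _ "{0, n}"]) (use a2_a1 in \<open>auto simp: a1_def split: if_splits\<close>)
    show "finite (sym_diff x y \<inter> b) \<or> almost_subset (sym_diff x y) b"
    proof (cases "finite (a \<inter> b)")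
      case True
      have "a2 \<inter> b \<subseteq> {0, n}"
        using a2_a1 True unfolding a1_def by auto
      then show ?thesis
        unfolding sd using finite_subset by blast
    next
      case False
      have "a2 - b \<subseteq> {0, n}"
        using a2_a1 False unfolding a1_def by auto
      then show ?thesis
        unfolding sd almost_subset_def using finite_subset by blast
    qed
    show "n \<in> sym_diff x y \<and> m \<notin> sym_diff x y" if "n \<noteq> m" "m \<noteq> 0"
      unfolding sd a2_def using that by auto
    show "splits_traces g R (insert x X) \<and> splits_traces g R (insert y Y)"
      if "(g, R) \<in> insert (f, S) \<G>" for g R
      using x(3,4)[OF that] unfolding y_def by blast
  qed
qed

text \<open>The value \<open>w\<close> is a triple \<open>(x, y, S)\<close>, and
  \<open>fst (v j) - fst (snd (v j))\<close> is the tower element of stage \<open>j\<close>. The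
  last conjunct concerns the splitting set of this stage and of all earlier ones, on all points
  chosen up to and including this stage.\<close>

definition stage :: "(nat set \<Rightarrow> (nat \<Rightarrow> borel_code) \<times> nat set \<times> nat \<times> nat) \<Rightarrow>
    (nat set \<Rightarrow> nat set \<times> nat set \<times> nat set) \<Rightarrow> nat set \<Rightarrow> nat set \<times> nat set \<times> nat set \<Rightarrow> bool" where
  "stage T v i w = (case (T i, w) of ((f, b, n, m), (x, y, S)) \<Rightarrow>
     0 \<in> x \<and> 0 \<notin> y \<and> infinite (x - y) \<and> infinite y \<and>
     (\<forall>j\<in>underS cord i. almost_subset (sym_diff x y) (fst (v j) - fst (snd (v j)))) \<and>
     (finite (sym_diff x y \<inter> b) \<or> almost_subset (sym_diff x y) b) \<and>
     (n \<noteq> m \<longrightarrow> m \<noteq> 0 \<longrightarrow> n \<in> sym_diff x y \<and> m \<notin> sym_diff x y) \<and>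
     (\<forall>(g, R)\<in>insert (f, S) ((\<lambda>j. (fst (T j), snd (snd (v j)))) ` underS cord i).
        splits_traces g R (insert x ((\<lambda>j. fst (v j)) ` underS cord i)) \<and>
        splits_traces g R (insert y ((\<lambda>j. fst (snd (v j))) ` underS cord i))))"

text \<open>Well-founded choice requires that a stage depend on earlier values only.\<close>

lemma stage_cong:
  assumes "\<And>j. j \<in> underS cord i \<Longrightarrow> v j = v' j"
  shows "stage T v i w = stage T v' i w"
proof -
  have "(\<lambda>j. h (v j) j) ` underS cord i = (\<lambda>j. h (v' j) j) ` underS cord i" for h :: "_ \<Rightarrow> _ \<Rightarrow> 'b"
    using assms by (intro image_cong) auto
  note eq = this[of "\<lambda>p j. (fst (T j), snd (snd p))"] this[of "\<lambda>p j. fst p"] this[of "\<lambda>p j. fst (snd p)"]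
  have "(\<forall>j\<in>underS cord i. almost_subset z (fst (v j) - fst (snd (v j)))) \<longleftrightarrow>
    (\<forall>j\<in>underS cord i. almost_subset z (fst (v' j) - fst (snd (v' j))))" for z
    using assms by simp
  then show ?thesis
    unfolding stage_def eq by simp
qed


lemma ex_stages:
  assumes t: "t_eq_c"
  obtains v where "\<And>i. stage T v i (v i)"
proof -
  have wf: "wf (cord - Id)"
    using cord_Well_order unfolding well_order_on_def by blast
  have "\<exists>v. \<forall>i. stage T v i (v i)"
  proof (rule dependent_wf_choice[OF wf])
    show "stage T v i w = stage T v' i w" if "\<And>j. (j, i) \<in> cord - Id \<Longrightarrow> v j = v' j" for v v' i w
      by (rule stage_cong) (use that in \<open>auto simp: underS_def\<close>)
    fix i v assume prev0: "\<And>j. (j, i) \<in> cord - Id \<Longrightarrow> stage T v j (v j)"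
    obtain X Y S where v: "v = (\<lambda>j. (X j, Y j, S j))"
      by (rule that[of "\<lambda>j. fst (v j)" "\<lambda>j. fst (snd (v j))" "\<lambda>j. snd (snd (v j))"]) simp
    obtain F B N M where T: "T = (\<lambda>j. (F j, B j, N j, M j))"
      by (rule that[of "\<lambda>j. fst (T j)" "\<lambda>j. fst (snd (T j))" "\<lambda>j. fst (snd (snd (T j)))"
            "\<lambda>j. snd (snd (snd (T j)))"]) simp
    have prev: "infinite (X j - Y j)"
      "\<And>k. k \<in> underS cord j \<Longrightarrow> almost_subset (sym_diff (X j) (Y j)) (X k - Y k)"
      "\<And>k. k = j \<or> k \<in> underS cord j \<Longrightarrow>
        splits_traces (F k) (S k) (insert (X j) (X ` underS cord j)) \<and>
        splits_traces (F k) (S k) (insert (Y j) (Y ` underS cord j))" if "j \<in> underS cord i" for j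
      using prev0[of j] that unfolding stage_def v T by (auto simp: underS_def)
    define U where "U = underS cord i"
    have good: "splits_traces (F j) (S j) (X ` U) \<and> splits_traces (F j) (S j) (Y ` U)" if j: "j \<in> U" for j
    proof -
      \<comment> \<open>Take the largest index among those of the points in \<open>G\<close> and
        \<open>j\<close>. Including \<open>j\<close> matters, since a stage speaks only of splitting
        sets chosen no later than itself.\<close>
      have chain: "\<exists>Z. G \<subseteq> Z \<and> splits_traces (F j) (S j) Z"
        if G: "finite G" "G \<subseteq> W ` U" and W: "W = X \<or> W = Y" for G W
      proof -
        obtain I where I: "I \<subseteq> U" "finite I" "G = W ` I"
          using finite_subset_image[OF G] by blast
        obtain k where k: "k \<in> insert j I" "\<forall>l\<in>insert j I. (l, k) \<in> cord"
          using Well_order_finite_max[OF cord_Well_order, of "insert j I"] I(2)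
          by (auto simp: cord_Field)
        have "k \<in> U"
          using k(1) j I(1) by blast
        moreover have "j = k \<or> j \<in> underS cord k"
          using k(2) by (auto simp: underS_def)
        ultimately have "splits_traces (F j) (S j) (insert (W k) (W ` underS cord k))"
          using prev(3)[of k j] W unfolding U_def by blast
        moreover have "G \<subseteq> insert (W k) (W ` underS cord k)"
          using k(2) unfolding I(3) underS_def by auto
        ultimately show ?thesis
          by blast
      qed
      show ?thesis
        by (intro conjI splits_traces_chain) (use chain[of _ X] chain[of _ Y] in simp_all)
    qed
    have "\<exists>a. infinite a \<and> (\<forall>j\<in>Field (Restr cord U). almost_subset a (X j - Y j))"
    proof (rule tower_pseudo_intersection[OF t])
      show "Well_order (Restr cord U)" "small (Field (Restr cord U))"
        unfolding U_def using Well_order_Restr_underS[OF cord_Well_order, of i] small_underS_cord[of i]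
        by simp_all
      show "infinite (X j - Y j)" if "j \<in> Field (Restr cord U)" for j
        using that prev(1) unfolding U_def by (auto simp: Field_def)
      show "almost_subset (X k - Y k) (X j - Y j)" if "(j, k) \<in> Restr cord U" for j k
      proof (cases "j = k")
        case False
        then have "almost_subset (sym_diff (X k) (Y k)) (X j - Y j)"
          using prev(2)[of k j] that unfolding U_def by (auto simp: underS_def)
        then show ?thesis
          by (rule almost_subset_mono) auto
      qed (simp add: almost_subset_refl)
    qed
    then obtain a where a: "infinite a" "\<forall>j\<in>U. almost_subset a (X j - Y j)"
      unfolding U_def Well_order_Restr_underS[OF cord_Well_order] by blast
    have sU: "small U"
      unfolding U_def by (rule small_underS_cord)
    obtain x y S' where next_stage: "0 \<in> x" "0 \<notin> y" "infinite (x - y)" "infinite y"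
      "almost_subset (sym_diff x y) a"
      "finite (sym_diff x y \<inter> B i) \<or> almost_subset (sym_diff x y) (B i)"
      "N i \<noteq> M i \<Longrightarrow> M i \<noteq> 0 \<Longrightarrow> N i \<in> sym_diff x y \<and> M i \<notin> sym_diff x y"
      "\<And>g R. (g, R) \<in> insert (F i, S') ((\<lambda>j. (F j, S j)) ` U) \<Longrightarrow>
        splits_traces g R (insert x (X ` U)) \<and> splits_traces g R (insert y (Y ` U))"
    proof (rule ex_next_stage[OF t, of "(\<lambda>j. (F j, S j)) ` U" "X ` U" "Y ` U" a "B i" "N i" "M i" "F i"])
      show "small ((\<lambda>j. (F j, S j)) ` U)" "small (X ` U)" "small (Y ` U)"
        using sU by (simp_all add: small_image)
      show "splits_traces f R (X ` U) \<and> splits_traces f R (Y ` U)"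
        if "(f, R) \<in> (\<lambda>j. (F j, S j)) ` U" for f R
        using that good by blast
      show "infinite a"
        by (rule a(1))
    qed (rule that; blast)
    have "stage T v i (x, y, S')"
      unfolding stage_def v T using next_stage a(2)
      by (auto simp: U_def[symmetric] intro: almost_subset_trans)
    then show "\<exists>w. stage T v i w" ..
  qed
  then show thesis
    using that by blast
qed

text \<open>Finite character again: finitely many points are all present at some stage not before
  \<open>j\<close>.\<close>

lemma splits_traces_cord_union:
  assumes "\<And>i. (j, i) \<in> cord \<Longrightarrow> splits_traces f S (insert (W i) (W ` underS cord i))"
  shows "splits_traces f S (range W)"
proof (rule splits_traces_chain)
  fix G assume "finite G" "G \<subseteq> range W"
  then obtain I where I: "finite I" "G = W ` I"
    using finite_subset_image by (metis subset_UNIV)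
  obtain k where k: "\<forall>l\<in>insert j I. (l, k) \<in> cord"
    using Well_order_finite_max[OF cord_Well_order, of "insert j I"] I(1) by (auto simp: cord_Field)
  then have "G \<subseteq> insert (W k) (W ` underS cord k)"
    unfolding I(2) underS_def by auto
  then show "\<exists>Y. G \<subseteq> Y \<and> splits_traces f S Y"
    using assms[of k] k by blast
qed

lemma ex_generic_tower:
  assumes t: "t_eq_c"
  obtains x y :: "nat set \<Rightarrow> nat set" where
    "\<And>i. 0 \<in> x i" "\<And>i. 0 \<notin> y i" "\<And>i. infinite (x i - y i)" "\<And>i. infinite (y i)"
    "\<And>i j. (j, i) \<in> cord \<Longrightarrow> j \<noteq> i \<Longrightarrow> almost_subset (sym_diff (x i) (y i)) (x j - y j)"
    "\<And>b. \<exists>i. finite (sym_diff (x i) (y i) \<inter> b) \<or> almost_subset (sym_diff (x i) (y i)) b"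
    "\<And>n m. n \<noteq> m \<Longrightarrow> m \<noteq> 0 \<Longrightarrow> \<exists>i. n \<in> sym_diff (x i) (y i) \<and> m \<notin> sym_diff (x i) (y i)"
    "\<And>f. \<exists>S. splits_traces f S (range x) \<and> splits_traces f S (range y)"
proof -
  obtain T :: "nat set \<Rightarrow> (nat \<Rightarrow> borel_code) \<times> nat set \<times> nat \<times> nat" where "surj T"
    using surj_nat_set_coding by blast
  obtain v where v: "\<And>i. stage T v i (v i)"
    using ex_stages[OF t] by blast
  define x where "x i = fst (v i)" for i
  define y where "y i = fst (snd (v i))" for i
  define S where "S i = snd (snd (v i))" for i
  have stage: "stage T (\<lambda>i. (x i, y i, S i)) i (x i, y i, S i)" for i
    using v unfolding x_def y_def S_def by simp
  have code: "\<exists>i. T i = p" for p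
    using \<open>surj T\<close> by (metis surjD)
  have sep: "\<exists>i. n \<in> sym_diff (x i) (y i) \<and> m \<notin> sym_diff (x i) (y i)"
    if nm: "n \<noteq> m" "m \<noteq> 0" for n m
  proof -
    \<comment> \<open>Every task occurs, so the components that do not matter here can be
      arbitrary.\<close>
    obtain i where i: "T i = (undefined, undefined, n, m)"
      using code by blast
    have "n \<in> sym_diff (x i) (y i) \<and> m \<notin> sym_diff (x i) (y i)"
      using stage[of i] nm unfolding stage_def i by simp
    then show ?thesis ..
  qed
  have dec: "\<exists>i. finite (sym_diff (x i) (y i) \<inter> b) \<or> almost_subset (sym_diff (x i) (y i)) b" for b
  proof -
    obtain i where i: "T i = (undefined, b, undefined, undefined)"
      using code by blast
    have "finite (sym_diff (x i) (y i) \<inter> b) \<or> almost_subset (sym_diff (x i) (y i)) b"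
      using stage[of i] unfolding stage_def i by simp
    then show ?thesis ..
  qed
  have split: "\<exists>S. splits_traces f S (range x) \<and> splits_traces f S (range y)" for f
  proof -
    obtain j where j: "T j = (f, undefined)"
      using code by blast
    have "splits_traces f (S j) (insert (x i) (x ` underS cord i)) \<and>
      splits_traces f (S j) (insert (y i) (y ` underS cord i))" if "(j, i) \<in> cord" for i
    proof (cases "j = i")
      case True
      then show ?thesis
        using stage[of i] j unfolding stage_def by (auto split: prod.splits)
    next
      case False
      then have "j \<in> underS cord i"
        using that by (simp add: underS_def)
      then show ?thesis
        using stage[of i] j unfolding stage_def by (fastforce split: prod.splits)
    qed
    then show ?thesis
      using splits_traces_cord_union[of j f "S j"] by meson
  qed
  have basic: "0 \<in> x i" "0 \<notin> y i" "infinite (x i - y i)" "infinite (y i)"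
    "\<And>j. j \<in> underS cord i \<Longrightarrow> almost_subset (sym_diff (x i) (y i)) (x j - y j)" for i
    using stage[of i] unfolding stage_def by (auto split: prod.splits)
  show thesis
  proof (rule that)
    show "almost_subset (sym_diff (x i) (y i)) (x j - y j)" if "(j, i) \<in> cord" "j \<noteq> i" for i j
      by (rule basic(5)) (use that in \<open>simp add: underS_def\<close>)
  qed (fact basic(1-4) sep dec split)+
qed

section \<open>Covers\<close>

lemma topspace_cantor [simp]: "topspace cantor_top = UNIV"
  by (simp add: cantor_top_def topspace_pullback_topology)

lemma openin_cantor_member: "openin cantor_top {x. (n \<in> x) = b}"
proof -
  let ?P = "product_topology (\<lambda>_. discrete_topology (UNIV :: bool set)) (UNIV :: nat set)"
  have "openin ?P {g \<in> topspace ?P. g n \<in> {b}}"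
    by (rule openin_continuous_map_preimage[OF continuous_map_product_projection]) auto
  then show ?thesis
    unfolding cantor_top_def openin_pullback_topology
    by (intro exI[of _ "{g. g n = b}"]) auto
qed

lemma openin_cantor_cylinder:
  assumes "openin cantor_top U" "x \<in> U"
  shows "\<exists>k. {z. pre z k = pre x k} \<subseteq> U"
proof -
  let ?P = "product_topology (\<lambda>_. discrete_topology (UNIV :: bool set)) (UNIV :: nat set)"
  let ?h = "\<lambda>A n. n \<in> A"
  obtain W where W: "openin ?P W" "U = ?h -` W"
    using assms(1) unfolding cantor_top_def openin_pullback_topology by auto
  then obtain V where V: "finite {i. V i \<noteq> UNIV}" "?h x \<in> Pi\<^sub>E UNIV V" "Pi\<^sub>E UNIV V \<subseteq> W"
    using assms(2) unfolding openin_product_topology_alt by fastforce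
  then obtain k where k: "\<And>i. V i \<noteq> UNIV \<Longrightarrow> i < k"
    unfolding finite_nat_set_iff_bounded by blast
  have "z \<in> U" if z: "pre z k = pre x k" for z
  proof -
    have "i \<in> z \<longleftrightarrow> i \<in> x" if "i < k" for i
      using z that pre_nth by metis
    then have "(i \<in> z) \<in> V i" for i
      using k[of i] V(2) by (cases "V i = UNIV") (auto simp: PiE_iff)
    then have "?h z \<in> W"
      using V(3) by (auto simp: PiE_iff)
    then show ?thesis
      using W(2) by simp
  qed
  then show ?thesis
    by blast
qed

lemma openin_cantor_code:
  assumes "openin cantor_top U"
  shows "\<exists>c. U = borel_set c"
proof -
  \<comment> \<open>\<open>Neg (Cyl [])\<close> codes the empty set, because every point extends the
    empty string.\<close>
  define f where "f n = (if borel_set (Cyl (from_nat n)) \<subseteq> U then Cyl (from_nat n) else Neg (Cyl []))" for n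
  have sub: "borel_set (f n) \<subseteq> U" for n
    unfolding f_def by (auto simp: pre_def split: if_splits)
  have "U \<subseteq> borel_set (Join f)"
  proof
    fix x assume "x \<in> U"
    then obtain k where k: "{z. pre z k = pre x k} \<subseteq> U"
      using openin_cantor_cylinder[OF assms] by blast
    then have "x \<in> borel_set (f (to_nat (pre x k)))"
      unfolding f_def by simp
    then show "x \<in> borel_set (Join f)"
      by auto
  qed
  then show ?thesis
    using sub by (intro exI[of _ "Join f"]) auto
qed

lemma borel_in_cantor_code:
  assumes "borel_in (subtopology cantor_top X) B"
  shows "\<exists>c. B = X \<inter> borel_set c"
  using assms unfolding borel_in_def
proof (induction rule: sigma_sets.induct)
  case (Basic a)
  then obtain U where "openin cantor_top U" "a = U \<inter> X"
    by (auto simp: openin_subtopology)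
  then show ?case
    using openin_cantor_code by blast
next
  case Empty
  show ?case
    by (intro exI[of _ "Neg (Cyl [])"]) (simp add: pre_def)
next
  case (Compl a)
  then obtain c where "a = X \<inter> borel_set c"
    by blast
  then show ?case
    by (intro exI[of _ "Neg c"]) auto
next
  case (Union a)
  then obtain f where "\<And>n. a n = X \<inter> borel_set (f n)"
    by metis
  then show ?case
    by (intro exI[of _ "Join f"]) auto
qed

text \<open>The coding \<open>to_nat_on\<close> also covers the finite case; unused indices get the empty set.\<close>

lemma coded_cover:
  assumes "countable \<U>" "\<And>U. U \<in> \<U> \<Longrightarrow> borel_in (subtopology cantor_top X) U"
  obtains f e where "inj_on e \<U>" "\<And>x. x \<in> X \<Longrightarrow> code_trace f x = e ` {U \<in> \<U>. x \<in> U}"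
proof -
  define e where "e = to_nat_on \<U>"
  have e: "inj_on e \<U>"
    unfolding e_def using assms(1) by (rule inj_on_to_nat_on)
  obtain c where c: "\<And>U. U \<in> \<U> \<Longrightarrow> U = X \<inter> borel_set (c U)"
    using borel_in_cantor_code[OF assms(2)] by metis
  define f where "f n = (if n \<in> e ` \<U> then c (inv_into \<U> e n) else Neg (Cyl []))" for n
  have "code_trace f x = e ` {U \<in> \<U>. x \<in> U}" if x: "x \<in> X" for x
  proof (rule set_eqI)
    fix n
    show "n \<in> code_trace f x \<longleftrightarrow> n \<in> e ` {U \<in> \<U>. x \<in> U}"
    proof (cases "n \<in> e ` \<U>")
      case True
      then obtain U where U: "U \<in> \<U>" "n = e U"
        by blast
      then have "f n = c U"
        using e by (simp add: f_def)
      moreover have "x \<in> U \<longleftrightarrow> x \<in> X \<inter> borel_set (c U)"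
        by (rule arg_cong[OF c[OF U(1)]])
      ultimately have "n \<in> code_trace f x \<longleftrightarrow> x \<in> U"
        using x unfolding code_trace_def by simp
      also have "\<dots> \<longleftrightarrow> n \<in> e ` {U \<in> \<U>. x \<in> U}"
        using U e by (auto dest: inj_onD)
      finally show ?thesis .
    next
      case False
      then have "n \<notin> code_trace f x"
        unfolding code_trace_def f_def by (simp add: pre_def)
      then show ?thesis
        using False by auto
    qed
  qed
  then show thesis
    using that e by blast
qed

section \<open>Splitting Borel covers\<close>

lemma Split_by_index:
  assumes "\<U> \<in> \<UU> T \<Longrightarrow> \<exists>\<A>. {U \<in> \<U>. U \<in> \<A>} \<in> \<VV> T \<and> {U \<in> \<U>. U \<notin> \<A>} \<in> \<VV> T"
    and "\<U> \<in> \<UU> T"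
  shows "\<exists>\<V>1 \<V>2. \<V>1 \<union> \<V>2 = \<U> \<and> \<V>1 \<inter> \<V>2 = {} \<and>
      (\<exists>\<W>1\<subseteq>\<V>1. \<W>1 \<in> \<VV> T) \<and> (\<exists>\<W>2\<subseteq>\<V>2. \<W>2 \<in> \<VV> T)"
proof -
  obtain \<A> where "{U \<in> \<U>. U \<in> \<A>} \<in> \<VV> T" "{U \<in> \<U>. U \<notin> \<A>} \<in> \<VV> T"
    using assms by blast
  moreover have "{U \<in> \<U>. U \<in> \<A>} \<union> {U \<in> \<U>. U \<notin> \<A>} = \<U>" "{U \<in> \<U>. U \<in> \<A>} \<inter> {U \<in> \<U>. U \<notin> \<A>} = {}"
    by auto
  ultimately show ?thesis
    by blast
qed

lemma large_cover_subfamily: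
  assumes "is_cover X \<U>" "\<V> \<subseteq> \<U>" "\<And>x. x \<in> X \<Longrightarrow> infinite {U \<in> \<V>. x \<in> U}"
  shows "large_cover X \<V>"
proof -
  have "x \<in> \<Union>\<V>" if "x \<in> X" for x
    using assms(3)[OF that] by (metis (no_types, lifting) Collect_empty_eq UnionI finite.emptyI)
  then show ?thesis
    using assms unfolding large_cover_def is_cover_def by blast
qed

text \<open>Up to the injective indexing, the trace at a point is the set of members containing it,
  so a set splitting all traces splits the cover.\<close>

lemma Split_B_Lambda:
  assumes "\<And>f. \<exists>S. \<forall>x\<in>X. splits S (code_trace f x)"
  shows "Split B_Lambda B_Lambda (subtopology cantor_top X)"
  unfolding Split_def
proof (intro ballI, rule Split_by_index)
  fix \<U> assume "\<U> \<in> B_Lambda (subtopology cantor_top X)"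
  then have U: "countable \<U>" "large_cover X \<U>" "\<And>U. U \<in> \<U> \<Longrightarrow> borel_in (subtopology cantor_top X) U"
    by (auto simp: B_Lambda_def)
  obtain f e where e: "inj_on e \<U>" "\<And>x. x \<in> X \<Longrightarrow> code_trace f x = e ` {U \<in> \<U>. x \<in> U}"
    using coded_cover[OF U(1,3)] by metis
  obtain S where S: "\<And>x. x \<in> X \<Longrightarrow> splits S (code_trace f x)"
    using assms by blast
  have inf: "infinite {U \<in> \<U>. e U \<in> S \<and> x \<in> U} \<and> infinite {U \<in> \<U>. e U \<notin> S \<and> x \<in> U}" if "x \<in> X" for x
  proof -
    have "infinite {U \<in> \<U>. x \<in> U}"
      using U(2) that unfolding large_cover_def by blast
    then have "infinite (code_trace f x)"
      using e that by (metis (no_types, lifting) finite_imageD inj_on_subset mem_Collect_eq subsetI)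
    then have "infinite (code_trace f x \<inter> S)" "infinite (code_trace f x - S)"
      using S[OF that] unfolding splits_def by auto
    moreover have "code_trace f x \<inter> S = e ` {U \<in> \<U>. e U \<in> S \<and> x \<in> U}" "code_trace f x - S = e ` {U \<in> \<U>. e U \<notin> S \<and> x \<in> U}"
      unfolding e(2)[OF that] by auto
    ultimately show ?thesis
      by auto
  qed
  have "large_cover X {U \<in> \<U>. e U \<in> S}" "large_cover X {U \<in> \<U>. e U \<notin> S}"
    by (rule large_cover_subfamily[of X \<U>]; use U(2) inf in \<open>simp add: large_cover_def conj_assoc\<close>; blast)+
  then show "\<exists>\<A>. {U \<in> \<U>. U \<in> \<A>} \<in> B_Lambda (subtopology cantor_top X) \<and>
      {U \<in> \<U>. U \<notin> \<A>} \<in> B_Lambda (subtopology cantor_top X)"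
    using U by (intro exI[of _ "e -` S"]) (auto simp: B_Lambda_def)
qed

text \<open>Were there only finitely many such members, adding to \<open>F\<close> one point outside
  each would give a finite set contained in no member.\<close>

lemma omega_cover_infinite:
  assumes U: "omega_cover X \<U>" and F: "finite F" "F \<subseteq> X"
  shows "infinite {U \<in> \<U>. F \<subseteq> U}"
proof
  assume fin: "finite {U \<in> \<U>. F \<subseteq> U}"
  have cover: "is_cover X \<U>" and omega: "\<And>G. finite G \<Longrightarrow> G \<subseteq> X \<Longrightarrow> \<exists>V\<in>\<U>. G \<subseteq> V"
    using U by (simp_all add: omega_cover_def)
  have "\<exists>p. p \<in> X - V" if "V \<in> \<U>" for V
  proof -
    have "\<not> X \<subseteq> V"
      using cover that unfolding is_cover_def by blast
    then show ?thesis
      by blast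
  qed
  then obtain p where p: "\<And>V. V \<in> \<U> \<Longrightarrow> p V \<in> X - V"
    by metis
  define G where "G = F \<union> p ` {U \<in> \<U>. F \<subseteq> U}"
  have "finite G" "G \<subseteq> X"
    using fin F p unfolding G_def by auto
  then obtain V where V: "V \<in> \<U>" "G \<subseteq> V"
    using omega by blast
  then have "p V \<in> G"
    unfolding G_def by auto
  then show False
    using p[OF V(1)] V(2) by auto
qed

lemma omega_cover_subfamily:
  assumes "is_cover X \<U>" "\<V> \<subseteq> \<U>"
    "\<And>F. finite F \<Longrightarrow> F \<subseteq> X \<Longrightarrow> F \<noteq> {} \<Longrightarrow> \<exists>U\<in>\<V>. F \<subseteq> U" "X \<noteq> {}"
  shows "omega_cover X \<V>"
proof -
  have omega: "\<exists>U\<in>\<V>. F \<subseteq> U" if "finite F" "F \<subseteq> X" for F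
  proof -
    obtain x where "x \<in> X"
      using assms(4) by blast
    then show ?thesis
      using assms(3)[of "insert x F"] that by auto
  qed
  have "x \<in> \<Union>\<V>" if "x \<in> X" for x
    using assms(3)[of "{x}"] that by auto
  then have "is_cover X \<V>"
    using assms(1,2) unfolding is_cover_def by blast
  then show ?thesis
    using omega by (simp add: omega_cover_def)
qed

text \<open>For nonempty \<open>F\<close> the meet of the traces is the index set of the members
  containing \<open>F\<close>; it is infinite and is therefore met on both sides of
  \<open>S\<close>. For \<open>F = {}\<close> the meet would be all of \<open>nat\<close>, hence the
  restriction.\<close>

lemma Split_B_Omega:
  assumes "\<And>f. \<exists>S. splits_traces f S X"
  shows "Split B_Omega B_Omega (subtopology cantor_top X)"
  unfolding Split_def
proof (intro ballI, rule Split_by_index)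
  fix \<U> assume "\<U> \<in> B_Omega (subtopology cantor_top X)"
  then have U: "countable \<U>" "omega_cover X \<U>" "\<And>U. U \<in> \<U> \<Longrightarrow> borel_in (subtopology cantor_top X) U"
    by (auto simp: B_Omega_def)
  obtain f e where e: "inj_on e \<U>" "\<And>x. x \<in> X \<Longrightarrow> code_trace f x = e ` {U \<in> \<U>. x \<in> U}"
    using coded_cover[OF U(1,3)] by metis
  obtain S where S: "splits_traces f S X"
    using assms by blast
  have ex: "(\<exists>U\<in>\<U>. e U \<in> S \<and> F \<subseteq> U) \<and> (\<exists>U\<in>\<U>. e U \<notin> S \<and> F \<subseteq> U)"
    if F: "finite F" "F \<subseteq> X" "F \<noteq> {}" for F
  proof -
    have eq: "meet_traces f F {} = e ` {U \<in> \<U>. F \<subseteq> U}"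
    proof
      show "e ` {U \<in> \<U>. F \<subseteq> U} \<subseteq> meet_traces f F {}"
        using F(2) e(2) unfolding meet_traces_def by fastforce
      show "meet_traces f F {} \<subseteq> e ` {U \<in> \<U>. F \<subseteq> U}"
      proof
        fix n assume n: "n \<in> meet_traces f F {}"
        have mem: "n \<in> e ` {U \<in> \<U>. x \<in> U}" if "x \<in> F" for x
          using n that F(2) e(2)[of x] unfolding meet_traces_def by auto
        obtain x where "x \<in> F"
          using F(3) by blast
        then obtain U where U': "U \<in> \<U>" "n = e U"
          using mem by blast
        have "F \<subseteq> U"
        proof
          fix z assume "z \<in> F"
          then obtain V where "V \<in> \<U>" "z \<in> V" "n = e V"
            using mem by blast
          then show "z \<in> U"
            using U' e(1) by (auto dest: inj_onD)
        qed
        then show "n \<in> e ` {U \<in> \<U>. F \<subseteq> U}"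
          using U' by blast
      qed
    qed
    have "infinite (meet_traces f F {})"
      unfolding eq using omega_cover_infinite[OF U(2) F(1,2)] e(1)
      by (metis (no_types, lifting) finite_imageD inj_on_subset mem_Collect_eq subsetI)
    moreover have "splits S (meet_traces f F {})"
      using S F unfolding splits_traces_def by (auto simp: Fpow_def)
    ultimately have "infinite (meet_traces f F {} \<inter> S)" "infinite (meet_traces f F {} - S)"
      unfolding splits_def by auto
    then have "meet_traces f F {} \<inter> S \<noteq> {}" "meet_traces f F {} - S \<noteq> {}"
      by force+
    then show ?thesis
      unfolding eq by auto
  qed
  have cover: "is_cover X \<U>"
    using U(2) by (simp add: omega_cover_def)
  \<comment> \<open>The cover has a member, and no member contains \<open>X\<close>, so
    \<open>X\<close> is nonempty.\<close>
  have "{V \<in> \<U>. {} \<subseteq> V} \<noteq> {}"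
    using omega_cover_infinite[OF U(2), of "{}"] by (intro notI) simp
  then have ne: "X \<noteq> {}"
    using cover unfolding is_cover_def by auto
  have "omega_cover X {U \<in> \<U>. e U \<in> S}"
    by (rule omega_cover_subfamily[OF cover]; use ex ne in blast)
  moreover have "omega_cover X {U \<in> \<U>. e U \<notin> S}"
    by (rule omega_cover_subfamily[OF cover]; use ex ne in blast)
  ultimately show "\<exists>\<A>. {U \<in> \<U>. U \<in> \<A>} \<in> B_Omega (subtopology cantor_top X) \<and>
      {U \<in> \<U>. U \<notin> \<A>} \<in> B_Omega (subtopology cantor_top X)"
    using U by (intro exI[of _ "e -` S"]) (auto simp: B_Omega_def)
qed

lemma splits_traces_imp_splits:
  assumes "splits_traces f S X" "x \<in> X"
  shows "splits S (code_trace f x)"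
proof -
  have "{x} \<in> Fpow X" "{} \<in> Fpow UNIV"
    using assms(2) by (auto simp: Fpow_def)
  then have "splits S (meet_traces f {x} {})"
    using assms(1) unfolding splits_traces_def by blast
  then show ?thesis
    by (simp add: meet_traces_def)
qed

section \<open>Clopen covers that cannot be split\<close>

text \<open>The negative results use the combinatorics of the tower alone; genericity does not
  enter.\<close>

locale generic_tower =
  fixes x y :: "nat set \<Rightarrow> nat set"
  assumes x0: "0 \<in> x i" and y0: "0 \<notin> y i"
    and infinite_diff: "infinite (x i - y i)"
    and tower: "(j, i) \<in> cord \<Longrightarrow> j \<noteq> i \<Longrightarrow> almost_subset (sym_diff (x i) (y i)) (x j - y j)"
    and deciding: "\<exists>i. finite (sym_diff (x i) (y i) \<inter> b) \<or> almost_subset (sym_diff (x i) (y i)) b"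
    and separating: "n \<noteq> m \<Longrightarrow> m \<noteq> 0 \<Longrightarrow> \<exists>i. n \<in> sym_diff (x i) (y i) \<and> m \<notin> sym_diff (x i) (y i)"
begin

text \<open>On \<open>range x \<times> range y\<close> this is the symmetric difference without \<open>0\<close>. On the other products,
  where \<open>0\<close> is not in the symmetric difference, it is the complement, so that \<open>phi\<close> always takes
  values in the filter generated by the tower \<open>x i - y i\<close>. Dropping \<open>0\<close> avoids the trivial
  member of the cover below.\<close>

definition "phi z = {n. 0 < n \<and> (n \<in> sym_diff (fst z) (snd z) \<longleftrightarrow> 0 \<in> sym_diff (fst z) (snd z))}"

definition "U X n = {z \<in> X. n \<in> phi z}"

definition "diag = range (\<lambda>i. (x i, y i))"

definition "L = range x \<union> range y"

lemma phi_diag: "phi (x i, y i) = sym_diff (x i) (y i) - {0}"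
  unfolding phi_def using x0[of i] y0[of i] by auto

lemma diag_subset: "diag \<subseteq> range x \<times> range y" "range x \<times> range y \<subseteq> L \<times> L"
  unfolding diag_def L_def by auto

lemma tower_core: "(j, i) \<in> cord \<Longrightarrow> almost_subset (x i - y i) (x j - y j)"
proof (cases "j = i")
  case False
  assume "(j, i) \<in> cord"
  from tower[OF this False] show ?thesis
    by (rule almost_subset_mono) auto
qed (simp add: almost_subset_refl)

text \<open>\<open>x k - y k\<close> is contained in \<open>x k\<close> and disjoint from
  \<open>y k\<close>; the marker \<open>0\<close> tells which of the two cases holds for
  \<open>p\<close>.\<close>

lemma L_decided:
  assumes "p \<in> L"
  shows "\<exists>k. \<forall>l. (k, l) \<in> cord \<longrightarrow> almost_subset (x l - y l) {n. n \<in> p \<longleftrightarrow> 0 \<in> p}"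
proof -
  obtain k where k: "p = x k \<or> p = y k"
    using assms unfolding L_def by blast
  have "x k - y k \<subseteq> {n. n \<in> p \<longleftrightarrow> 0 \<in> p}"
    using k x0[of k] y0[of k] by auto
  then have "almost_subset (x l - y l) {n. n \<in> p \<longleftrightarrow> 0 \<in> p}" if "(k, l) \<in> cord" for l
    using almost_subset_mono[OF tower_core[OF that] order_refl] by blast
  then show ?thesis
    by blast
qed

text \<open>On a late tower element, almost every \<open>n\<close> behaves like \<open>0\<close>
  with respect to both components, hence also with respect to their sum.\<close>

lemma phi_in_filter:
  assumes "z \<in> L \<times> L"
  shows "\<exists>k. almost_subset (x k - y k) (phi z)"
proof -
  obtain p q where z: "z = (p, q)" "p \<in> L" "q \<in> L"
    using assms by blast
  obtain k l where kl: "\<And>i. (k, i) \<in> cord \<Longrightarrow> almost_subset (x i - y i) {n. n \<in> p \<longleftrightarrow> 0 \<in> p}"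
    "\<And>i. (l, i) \<in> cord \<Longrightarrow> almost_subset (x i - y i) {n. n \<in> q \<longleftrightarrow> 0 \<in> q}"
    using L_decided z(2,3) by meson
  obtain i where i: "(k, i) \<in> cord" "(l, i) \<in> cord"
    using cord_total[of k l] cord_refl by blast
  \<comment> \<open>The summand \<open>{0}\<close> accounts for the condition \<open>0 < n\<close>
    in \<open>phi\<close>.\<close>
  have "x i - y i - phi z \<subseteq> (x i - y i - {n. n \<in> p \<longleftrightarrow> 0 \<in> p}) \<union> (x i - y i - {n. n \<in> q \<longleftrightarrow> 0 \<in> q}) \<union> {0}"
    unfolding z(1) phi_def by auto
  then show ?thesis
    using kl(1)[OF i(1)] kl(2)[OF i(2)] unfolding almost_subset_def
    by (intro exI[of _ i]) (erule finite_subset, simp)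
qed

lemma infinite_phi: "z \<in> L \<times> L \<Longrightarrow> infinite (phi z)"
  using phi_in_filter almost_subset_infinite infinite_diff by (meson finite_Int)

text \<open>Intersecting each value with a tower element almost contained in it changes that element
  only finitely, and tower elements are linearly ordered by almost inclusion.\<close>

lemma linearly_refinable_phi:
  assumes "X \<subseteq> L \<times> L"
  shows "linearly_refinable (phi ` X)"
proof -
  have "\<exists>k. almost_subset (x k - y k) Y" if "Y \<in> phi ` X" for Y
    using that assms phi_in_filter by blast
  then obtain k where k: "\<And>Y. Y \<in> phi ` X \<Longrightarrow> almost_subset (x (k Y) - y (k Y)) Y"
    by metis
  define g where "g Y = (x (k Y) - y (k Y)) \<inter> Y" for Y
  have lin: "almost_subset (g Z) (g Y)" if "Y \<in> phi ` X" "(k Y, k Z) \<in> cord" for Y Z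
  proof -
    have "g Z - g Y \<subseteq> ((x (k Z) - y (k Z)) - (x (k Y) - y (k Y))) \<union> ((x (k Y) - y (k Y)) - Y)"
      unfolding g_def by auto
    then show ?thesis
      using tower_core[OF that(2)] k[OF that(1)] unfolding almost_subset_def
      by (meson finite_UnI finite_subset)
  qed
  show ?thesis
    unfolding linearly_refinable_def
  proof (intro exI[of _ g] conjI ballI)
    show "infinite (g Y)" if "Y \<in> phi ` X" for Y
      unfolding g_def using k[OF that] infinite_diff by (rule almost_subset_infinite)
    show "almost_subset (g Y) (g Z) \<or> almost_subset (g Z) (g Y)"
      if "Y \<in> phi ` X" "Z \<in> phi ` X" for Y Z
      using that lin cord_total by blast
  qed (simp add: g_def)
qed

context
  fixes X :: "(nat set \<times> nat set) set"
  assumes X: "diag \<subseteq> X" "X \<subseteq> L \<times> L"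
begin

text \<open>A split partitions the family and not its indices, so repetitions must be excluded; this
  is the purpose of separating pairs of numbers in the recursion.\<close>

lemma inj_U: "inj_on (U X) {0<..}"
proof (rule inj_onI)
  fix n m :: nat assume nm: "n \<in> {0<..}" "m \<in> {0<..}" and eq: "U X n = U X m"
  show "n = m"
  proof (rule ccontr)
    assume "n \<noteq> m"
    then obtain i where i: "n \<in> sym_diff (x i) (y i)" "m \<notin> sym_diff (x i) (y i)"
      using separating[of n m] nm by auto
    have "(x i, y i) \<in> X"
      using X(1) unfolding diag_def by blast
    then have "(x i, y i) \<in> U X n" "(x i, y i) \<notin> U X m"
      using i nm unfolding U_def by (simp_all add: phi_diag)
    then show False
      using eq by simp
  qed
qed

lemma phi_positive: "phi z \<subseteq> {0<..}"
  unfolding phi_def by auto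

lemma U_members:
  assumes "z \<in> X"
  shows "{V \<in> U X ` {0<..}. z \<in> V \<and> P V} = U X ` {n \<in> phi z. P (U X n)}"
proof -
  have "z \<in> U X n \<longleftrightarrow> n \<in> phi z" for n
    using assms by (simp add: U_def)
  then show ?thesis
    using phi_positive[of z] by blast
qed

lemma infinite_U_image: "A \<subseteq> {0<..} \<Longrightarrow> finite (U X ` A) \<longleftrightarrow> finite A"
  using inj_U by (meson finite_image_iff inj_on_subset)

lemma is_cover_U: "is_cover X (U X ` {0<..})"
  unfolding is_cover_def
proof
  have "z \<in> \<Union>(U X ` {0<..})" if "z \<in> X" for z
  proof -
    have "phi z \<noteq> {}"
      using infinite_phi[of z] X(2) that by auto
    then show ?thesis
      using that phi_positive unfolding U_def by blast
  qed
  then show "\<Union>(U X ` {0<..}) = X"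
    unfolding U_def by blast
  show "\<forall>V\<in>U X ` {0<..}. \<not> X \<subseteq> V"
  proof
    fix V assume "V \<in> U X ` {0<..}"
    then obtain m where m: "V = U X m" "0 < m"
      by blast
    \<comment> \<open>Separating \<open>0\<close> from \<open>m\<close> gives a point of the
      diagonal outside \<open>U X m\<close>.\<close>
    then obtain i where i: "m \<notin> sym_diff (x i) (y i)"
      using separating[of 0 m] by blast
    have "(x i, y i) \<in> X - U X m"
      using X(1) i unfolding diag_def U_def by (auto simp: phi_diag)
    then show "\<not> X \<subseteq> V"
      using m by blast
  qed
qed

lemma large_cover_U: "large_cover X (U X ` {0<..})"
  unfolding large_cover_def
proof (intro conjI ballI is_cover_U)
  fix z assume z: "z \<in> X"
  have "infinite (U X ` phi z)"
    using infinite_U_image[OF phi_positive] infinite_phi[of z] X(2) z by blast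
  then show "infinite {V \<in> U X ` {0<..}. z \<in> V}"
    using U_members[OF z, of "\<lambda>_. True"] by simp
qed

lemma tau_star_cover_U: "tau_star_cover X (U X ` {0<..})"
  unfolding tau_star_cover_def
proof (intro conjI is_cover_U exI[of _ "{0<..}"] exI[of _ "U X"])
  show "bij_betw (U X) {0<..} (U X ` {0<..})"
    using inj_U by (simp add: bij_betw_def)
  have trace_eq: "{n \<in> {0<..}. z \<in> U X n} = phi z" if "z \<in> X" for z
    using that phi_positive unfolding U_def by blast
  then show "\<forall>z\<in>X. infinite {n \<in> {0<..}. z \<in> U X n}"
    using infinite_phi X(2) by auto
  have "(\<lambda>z. {n \<in> {0<..}. z \<in> U X n}) ` X = phi ` X"
    using trace_eq by (intro image_cong) auto
  then show "linearly_refinable ((\<lambda>z. {n \<in> {0<..}. z \<in> U X n}) ` X)"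
    using linearly_refinable_phi[OF X(2)] by simp
qed

text \<open>Membership depends only on whether \<open>0\<close> and \<open>n\<close> belong to the
  two components.\<close>

lemma clopen_U:
  assumes "V \<in> U X ` {0<..}"
  defines "T \<equiv> subtopology (prod_topology cantor_top cantor_top) X"
  shows "openin T V \<and> closedin T V"
proof -
  let ?P = "prod_topology cantor_top cantor_top"
  obtain n where n: "V = U X n" "n > 0"
    using assms(1) by blast
  have coord: "openin ?P {z. (k \<in> sym_diff (fst z) (snd z)) = b}" for k b
  proof -
    have "openin ?P ({p. (k \<in> p) = c} \<times> {q. (k \<in> q) = d})" for c d
      by (simp add: openin_prod_Times_iff openin_cantor_member)
    then have "openin ?P (({p. (k \<in> p) = b} \<times> {q. (k \<in> q) = False}) \<union> ({p. (k \<in> p) = (\<not> b)} \<times> {q. (k \<in> q) = True}))"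
      by blast
    also have "({p. (k \<in> p) = b} \<times> {q. (k \<in> q) = False}) \<union> ({p. (k \<in> p) = (\<not> b)} \<times> {q. (k \<in> q) = True}) =
      {z. (k \<in> sym_diff (fst z) (snd z)) = b}"
      by auto
    finally show ?thesis .
  qed
  have op: "openin ?P {z. (n \<in> sym_diff (fst z) (snd z) \<longleftrightarrow> 0 \<in> sym_diff (fst z) (snd z)) = b}" for b
  proof -
    have "openin ?P (({z. (n \<in> sym_diff (fst z) (snd z)) = b} \<inter> {z. (0 \<in> sym_diff (fst z) (snd z)) = True}) \<union>
        ({z. (n \<in> sym_diff (fst z) (snd z)) = (\<not> b)} \<inter> {z. (0 \<in> sym_diff (fst z) (snd z)) = False}))"
      by (intro openin_Un openin_Int coord)
    also have "({z. (n \<in> sym_diff (fst z) (snd z)) = b} \<inter> {z. (0 \<in> sym_diff (fst z) (snd z)) = True}) \<union>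
        ({z. (n \<in> sym_diff (fst z) (snd z)) = (\<not> b)} \<inter> {z. (0 \<in> sym_diff (fst z) (snd z)) = False}) =
        {z. (n \<in> sym_diff (fst z) (snd z) \<longleftrightarrow> 0 \<in> sym_diff (fst z) (snd z)) = b}"
      by auto
    finally show ?thesis .
  qed
  have V: "V = {z. (n \<in> sym_diff (fst z) (snd z) \<longleftrightarrow> 0 \<in> sym_diff (fst z) (snd z)) = True} \<inter> X"
    "X - V = {z. (n \<in> sym_diff (fst z) (snd z) \<longleftrightarrow> 0 \<in> sym_diff (fst z) (snd z)) = False} \<inter> X"
    using n unfolding U_def phi_def by auto
  have "openin T V" "openin T (X - V)"
    unfolding T_def openin_subtopology using op V by blast+
  moreover have "topspace T = X" "V \<subseteq> X"
    unfolding T_def n(1) U_def by auto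
  ultimately show ?thesis
    by (simp add: closedin_def)
qed

lemma topspace_U: "topspace (subtopology (prod_topology cantor_top cantor_top) X) = X"
  by simp

text \<open>A partition of the cover is a set \<open>b\<close> of indices, and some sum
  \<open>sym_diff (x i) (y i)\<close> is almost contained in \<open>b\<close> or almost disjoint
  from it. The point \<open>(x i, y i)\<close> then lies in only finitely many members of one half,
  which therefore contains no large cover.\<close>

lemma not_Split_U:
  assumes "U X ` {0<..} \<in> \<UU> (subtopology (prod_topology cantor_top cantor_top) X)"
    and large: "\<And>\<W>. \<W> \<in> \<VV> (subtopology (prod_topology cantor_top cantor_top) X) \<Longrightarrow> large_cover X \<W>"
  shows "\<not> Split \<UU> \<VV> (subtopology (prod_topology cantor_top cantor_top) X)"
proof
  assume "Split \<UU> \<VV> (subtopology (prod_topology cantor_top cantor_top) X)"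
  then obtain V1 V2 W1 W2 where V: "V1 \<union> V2 = U X ` {0<..}" "V1 \<inter> V2 = {}" "W1 \<subseteq> V1" "W2 \<subseteq> V2"
    and W: "large_cover X W1" "large_cover X W2"
    using assms unfolding Split_def by meson
  define b where "b = {n. U X n \<in> V1}"
  obtain i where i: "finite (sym_diff (x i) (y i) \<inter> b) \<or> almost_subset (sym_diff (x i) (y i)) b"
    using deciding by blast
  have z: "(x i, y i) \<in> X"
    using X(1) unfolding diag_def by blast
  have members: "{V \<in> \<V>. (x i, y i) \<in> V} \<subseteq> U X ` {n \<in> sym_diff (x i) (y i). U X n \<in> \<V>}"
    if \<V>: "\<V> \<subseteq> U X ` {0<..}" for \<V>
  proof
    fix V assume "V \<in> {V \<in> \<V>. (x i, y i) \<in> V}"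
    moreover from this obtain n where "V = U X n"
      using \<V> by blast
    ultimately show "V \<in> U X ` {n \<in> sym_diff (x i) (y i). U X n \<in> \<V>}"
      unfolding U_def phi_diag[symmetric] by (auto simp: phi_diag)
  qed
  have sub: "V1 \<subseteq> U X ` {0<..}" "V2 \<subseteq> U X ` {0<..}"
    using V(1) by auto
  have "finite {V \<in> V1. (x i, y i) \<in> V} \<or> finite {V \<in> V2. (x i, y i) \<in> V}"
    using i
  proof
    assume "finite (sym_diff (x i) (y i) \<inter> b)"
    moreover have "{n \<in> sym_diff (x i) (y i). U X n \<in> V1} = sym_diff (x i) (y i) \<inter> b"
      unfolding b_def by auto
    ultimately have "finite (U X ` {n \<in> sym_diff (x i) (y i). U X n \<in> V1})"
      by simp
    then show ?thesis
      using finite_subset[OF members[OF sub(1)]] by blast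
  next
    assume "almost_subset (sym_diff (x i) (y i)) b"
    moreover have "{n \<in> sym_diff (x i) (y i). U X n \<in> V2} \<subseteq> sym_diff (x i) (y i) - b"
      unfolding b_def using V(2) by auto
    ultimately have "finite {n \<in> sym_diff (x i) (y i). U X n \<in> V2}"
      unfolding almost_subset_def using finite_subset by blast
    then show ?thesis
      using finite_subset[OF members[OF sub(2)]] by blast
  qed
  moreover have W_sub: "{V \<in> W1. (x i, y i) \<in> V} \<subseteq> {V \<in> V1. (x i, y i) \<in> V}"
    "{V \<in> W2. (x i, y i) \<in> V} \<subseteq> {V \<in> V2. (x i, y i) \<in> V}"
    using V(3,4) by auto
  ultimately have "finite {V \<in> W1. (x i, y i) \<in> V} \<or> finite {V \<in> W2. (x i, y i) \<in> V}"
    using W_sub[THEN finite_subset] by argo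
  moreover have "infinite {V \<in> W1. (x i, y i) \<in> V}" "infinite {V \<in> W2. (x i, y i) \<in> V}"
    using W z by (simp_all add: large_cover_def)
  ultimately show False
    by argo
qed

lemma not_Split_C_Tstar:
  "\<not> Split C_Tstar C_Lambda (subtopology (prod_topology cantor_top cantor_top) X)"
proof (rule not_Split_U)
  show "U X ` {0<..} \<in> C_Tstar (subtopology (prod_topology cantor_top cantor_top) X)"
    unfolding C_Tstar_def topspace_U using tau_star_cover_U clopen_U by simp
  show "large_cover X \<W>" if "\<W> \<in> C_Lambda (subtopology (prod_topology cantor_top cantor_top) X)" for \<W>
    using that unfolding C_Lambda_def topspace_U by simp
qed

end

text \<open>On the diagonal the sums themselves decrease modulo finite sets: a later one is almost
  contained in \<open>x i - y i\<close>, which is part of the earlier sum. On the full products,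
  linearity is only obtained after refining the values.\<close>

lemma tau_cover_diag: "tau_cover diag (U diag ` {0<..})"
proof -
  have sub: "diag \<subseteq> diag" "diag \<subseteq> L \<times> L"
    using diag_subset by auto
  have fin: "finite {V \<in> U diag ` {0<..}. (x j, y j) \<in> V \<and> (x i, y i) \<notin> V}" if "(i, j) \<in> cord" for i j
  proof (cases "i = j")
    case False
    have ij: "(x i, y i) \<in> diag" "(x j, y j) \<in> diag"
      unfolding diag_def by auto
    have "{n \<in> phi (x j, y j). (x i, y i) \<notin> U diag n} \<subseteq> sym_diff (x j) (y j) - (x i - y i)"
      unfolding U_def using ij by (auto simp: phi_diag)
    then have "finite {n \<in> phi (x j, y j). (x i, y i) \<notin> U diag n}"
      using tower[OF that False] finite_subset unfolding almost_subset_def by blast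
    then show ?thesis
      using U_members[OF sub ij(2), of "\<lambda>V. (x i, y i) \<notin> V"] by simp
  qed simp
  show ?thesis
    unfolding tau_cover_def
  proof (intro conjI ballI)
    show "large_cover diag (U diag ` {0<..})"
      by (rule large_cover_U[OF sub])
    fix z z' assume "z \<in> diag" "z' \<in> diag"
    then obtain i j where "z = (x i, y i)" "z' = (x j, y j)"
      unfolding diag_def by blast
    then show "finite {V \<in> U diag ` {0<..}. z \<in> V \<and> z' \<notin> V} \<or> finite {V \<in> U diag ` {0<..}. z' \<in> V \<and> z \<notin> V}"
      using fin cord_total[of i j] by blast
  qed
qed

lemma not_Split_C_T_diag:
  "\<not> Split C_T C_T (subtopology (prod_topology cantor_top cantor_top) diag)"
proof -
  have sub: "diag \<subseteq> diag" "diag \<subseteq> L \<times> L"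
    using diag_subset by auto
  show ?thesis
  proof (rule not_Split_U[OF sub])
    show "U diag ` {0<..} \<in> C_T (subtopology (prod_topology cantor_top cantor_top) diag)"
      unfolding C_T_def topspace_U[OF sub] using tau_cover_diag clopen_U[OF sub] by simp
    show "large_cover diag \<W>" if "\<W> \<in> C_T (subtopology (prod_topology cantor_top cantor_top) diag)" for \<W>
      using that unfolding C_T_def topspace_U[OF sub] tau_cover_def by simp
  qed
qed

end

theorem theorem8p3:
  assumes "t_eq_c"
  shows "\<exists>L0 L1. L0 \<subseteq> inf_subsets \<and> L1 \<subseteq> inf_subsets \<and>
    Split B_Omega B_Omega (subtopology cantor_top L0) \<and>
    Split B_Lambda B_Lambda (subtopology cantor_top L0) \<and>
    Split B_Omega B_Omega (subtopology cantor_top L1) \<and>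
    Split B_Lambda B_Lambda (subtopology cantor_top L1) \<and>
    Split B_Lambda B_Lambda (subtopology cantor_top (L0 \<union> L1)) \<and>
    \<not> Split C_Tstar C_Lambda (subtopology (prod_topology cantor_top cantor_top) (L0 \<times> L1)) \<and>
    \<not> Split C_Tstar C_Lambda
        (subtopology (prod_topology cantor_top cantor_top) ((L0 \<union> L1) \<times> (L0 \<union> L1))) \<and>
    (\<exists>S \<subseteq> L0 \<times> L1. \<not> Split C_T C_T (subtopology (prod_topology cantor_top cantor_top) S))"
proof -
  obtain x y :: "nat set \<Rightarrow> nat set" where xy:
    "\<And>i. 0 \<in> x i" "\<And>i. 0 \<notin> y i" "\<And>i. infinite (x i - y i)" "\<And>i. infinite (y i)"
    "\<And>i j. (j, i) \<in> cord \<Longrightarrow> j \<noteq> i \<Longrightarrow> almost_subset (sym_diff (x i) (y i)) (x j - y j)"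
    "\<And>b. \<exists>i. finite (sym_diff (x i) (y i) \<inter> b) \<or> almost_subset (sym_diff (x i) (y i)) b"
    "\<And>n m. n \<noteq> m \<Longrightarrow> m \<noteq> 0 \<Longrightarrow> \<exists>i. n \<in> sym_diff (x i) (y i) \<and> m \<notin> sym_diff (x i) (y i)"
    "\<And>f. \<exists>S. splits_traces f S (range x) \<and> splits_traces f S (range y)"
    using ex_generic_tower[OF assms] by metis
  interpret generic_tower x y
    by standard (fact xy(1-3,5-7))+
  \<comment> \<open>The common splitting set works for single points of both families.\<close>
  have split: "\<exists>S. \<forall>z\<in>range x \<union> range y. splits S (code_trace f z)" for f
    using xy(8)[of f] splits_traces_imp_splits by blast
  show ?thesis
  proof (rule exI[of _ "range x"], rule exI[of _ "range y"], intro conjI)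
    show "range x \<subseteq> inf_subsets" "range y \<subseteq> inf_subsets"
      using xy(3,4) unfolding inf_subsets_def by (auto dest: finite_Diff)
    show "Split B_Omega B_Omega (subtopology cantor_top (range x))"
      "Split B_Omega B_Omega (subtopology cantor_top (range y))"
      by (rule Split_B_Omega, use xy(8) in blast)+
    show "Split B_Lambda B_Lambda (subtopology cantor_top (range x))"
      "Split B_Lambda B_Lambda (subtopology cantor_top (range y))"
      "Split B_Lambda B_Lambda (subtopology cantor_top (range x \<union> range y))"
      by (rule Split_B_Lambda, use split in blast)+
    show "\<not> Split C_Tstar C_Lambda (subtopology (prod_topology cantor_top cantor_top) (range x \<times> range y))"
      by (rule not_Split_C_Tstar[OF diag_subset])
    show "\<not> Split C_Tstar C_Lambda
        (subtopology (prod_topology cantor_top cantor_top) ((range x \<union> range y) \<times> (range x \<union> range y)))"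
      by (rule not_Split_C_Tstar[unfolded L_def]) (use diag_subset in \<open>auto simp: L_def\<close>)
    show "\<exists>S\<subseteq>range x \<times> range y. \<not> Split C_T C_T (subtopology (prod_topology cantor_top cantor_top) S)"
      using not_Split_C_T_diag diag_subset(1) by blast
  qed
qed

end
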